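(* Let $\Bbbk$ be a field and $H=\Bbbk[T]$. Every Leibniz algebra $L$ over $\Bbbk$ can be embedded into the current conformal algebra over the algebra of linear transformations of a linear space: there exist a linear space $W$ over $\Bbbk$ and an injective linear map $\rho: L\to \mathrm{Cur}\,\mathrm{End}\, W$ such that $$\rho([ab])=\rho(a)\vdash\rho(b)-\rho(b)\dashv\rho(a)\quad\text{for all } a,b\in L,$$ where $\vdash,\dashv$ are the operations of the dialgebra $(\mathrm{Cur}\,\mathrm{End}\, W)^{(0)}$. If $L$ is finite-dimensional, then $W$ can be chosen finite-dimensional.
   Context: A (left) Leibniz algebra is a linear space with a bilinear operation $[\cdot\,\cdot]$ satisfying $[x_1[x_2x_3]]=[[x_1x_2]x_3]+[x_2[x_1x_3]]$. $H=\Bbbk[T]$ has the Hopf algebra structure $\Delta(T)=T\otimes1+1\otimes T$, $\varepsilon(h)=h(0)$, $S(h)=h(-T)$, with Sweedler notation $\Delta(h)=h_{(1)}\otimes h_{(2)}$. $H^{\otimes 2}=H\otimes H$ is a right $H$-module via $(f\otimes g)h=fh_{(1)}\otimes gh_{(2)}$. If $\{h_i\}$ is a $\Bbbk$-basis of $H$, then $\{h_i\otimes1\}$ is a basis of $H\otimes H$ as a free right $H$-module. A conformal linear map of a left $H$-module $C$ to itself is a $\Bbbk$-linear map $a:C\to H^{\otimes2}\otimes_H C$ with $a(hu)=(1\otimes h\otimes_H\mathrm{id})a(u)$; the space $\mathrm{Cend}\, C$ of these is a left $H$-module via $(ha)(u)=(h\otimes1\otimes_H\mathrm{id})a(u)$.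 An $H$-conformal algebra is a left $H$-module $C$ with an $H$-linear map $\mu:C\to\mathrm{Cend}\, C$; its pseudo-product is $a*b=\mu(a)b\in H^{\otimes2}\otimes_H C$. For an ordinary algebra $A$ over $\Bbbk$, the current conformal algebra $\mathrm{Cur}\, A$ is the free $H$-module $H\otimes A$ with pseudo-product $(f\otimes a)*(h\otimes b)=f\otimes h\otimes_H(1\otimes ab)$, $f,h\in H$, $a,b\in A$. For an $H$-conformal algebra $C$, $C^{(0)}$ denotes the dialgebra (linear space with two bilinear operations) on the space $C$ with operations defined as follows: if $a*b=\sum_i h_i\otimes1\otimes_H c_i$ with $h_i\in H$, $c_i\in C$, then $a\vdash b=\sum_i\varepsilon(h_i)c_i$ and $a\dashv b=\sum_i h_ic_i$. $\mathrm{End}\, W$ is the associative algebra of all linear transformations of $W$. *)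

theory Defs
  imports
    "Jordan_Normal_Form.Missing_VectorSpace"
    "HOL-Algebra.Free_Abelian_Groups"
    "HOL-Algebra.UnivPoly"
begin

section \<open>Leibniz algebras and algebras of linear transformations\<close>

text \<open>
  An algebra over \<open>K\<close> is a module record over \<open>K\<close>, its product being the ring
  multiplication of the record, with no ring axiom imposed on it. The bracket of a Leibniz
  algebra is that product.
\<close>

locale leibniz_algebra = vectorspace K L
  for K :: "('k, 'm) ring_scheme" and L :: "('k, 'l, 'n) module_scheme" +
  assumes bracket_closed:
      "\<lbrakk>x \<in> carrier L; y \<in> carrier L\<rbrakk> \<Longrightarrow> x \<otimes>\<^bsub>L\<^esub> y \<in> carrier L"
    and bracket_add_left:
      "\<lbrakk>x \<in> carrier L; y \<in> carrier L; z \<in> carrier L\<rbrakk>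
        \<Longrightarrow> (x \<oplus>\<^bsub>L\<^esub> y) \<otimes>\<^bsub>L\<^esub> z = x \<otimes>\<^bsub>L\<^esub> z \<oplus>\<^bsub>L\<^esub> y \<otimes>\<^bsub>L\<^esub> z"
    and bracket_add_right:
      "\<lbrakk>x \<in> carrier L; y \<in> carrier L; z \<in> carrier L\<rbrakk>
        \<Longrightarrow> z \<otimes>\<^bsub>L\<^esub> (x \<oplus>\<^bsub>L\<^esub> y) = z \<otimes>\<^bsub>L\<^esub> x \<oplus>\<^bsub>L\<^esub> z \<otimes>\<^bsub>L\<^esub> y"
    and bracket_smult_left:
      "\<lbrakk>c \<in> carrier K; x \<in> carrier L; y \<in> carrier L\<rbrakk>
        \<Longrightarrow> (c \<odot>\<^bsub>L\<^esub> x) \<otimes>\<^bsub>L\<^esub> y = c \<odot>\<^bsub>L\<^esub> (x \<otimes>\<^bsub>L\<^esub> y)"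
    and bracket_smult_right:
      "\<lbrakk>c \<in> carrier K; x \<in> carrier L; y \<in> carrier L\<rbrakk>
        \<Longrightarrow> x \<otimes>\<^bsub>L\<^esub> (c \<odot>\<^bsub>L\<^esub> y) = c \<odot>\<^bsub>L\<^esub> (x \<otimes>\<^bsub>L\<^esub> y)"
    and left_leibniz:
      "\<lbrakk>x \<in> carrier L; y \<in> carrier L; z \<in> carrier L\<rbrakk>
        \<Longrightarrow> x \<otimes>\<^bsub>L\<^esub> (y \<otimes>\<^bsub>L\<^esub> z) = (x \<otimes>\<^bsub>L\<^esub> y) \<otimes>\<^bsub>L\<^esub> z \<oplus>\<^bsub>L\<^esub> y \<otimes>\<^bsub>L\<^esub> (x \<otimes>\<^bsub>L\<^esub> z)"

text \<open>
  Linear transformations are taken extensional, so that equality of transformations is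
  equality of HOL functions.
\<close>

definition End_algebra ::
  "('k, 'm) ring_scheme \<Rightarrow> ('k, 'w, 'n) module_scheme \<Rightarrow> ('k, 'w \<Rightarrow> 'w) module" where
  "End_algebra K W = \<lparr>
     carrier = module_hom K W W \<inter> extensional (carrier W),
     mult = (\<lambda>f g. compose (carrier W) f g),
     one = (\<lambda>w\<in>carrier W. w),
     ring.zero = (\<lambda>w\<in>carrier W. \<zero>\<^bsub>W\<^esub>),
     add = (\<lambda>f g. \<lambda>w\<in>carrier W. f w \<oplus>\<^bsub>W\<^esub> g w),
     smult = (\<lambda>c f. \<lambda>w\<in>carrier W. c \<odot>\<^bsub>W\<^esub> f w)\<rparr>"


section \<open>Tensor products\<close>

text \<open>
  The tensor product over a commutative ring \<open>R\<close> is the free abelian group on the pairs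
  modulo the usual relators. As \<open>R\<close> is commutative, a right module \<open>M\<close> is recorded as a
  left one: \<open>r \<odot>\<^bsub>M\<^esub> m\<close> stands for \<open>m r\<close> in the relator \<open>(m r, n) - (m, r n)\<close>.
\<close>

type_synonym ('a, 'b) tens = "(('a \<times> 'b) \<Rightarrow>\<^sub>0 int) set"

definition tensor_relators ::
  "('r, 'm) ring_scheme \<Rightarrow> ('r, 'a, 'p) module_scheme \<Rightarrow> ('r, 'b, 'q) module_scheme
    \<Rightarrow> (('a \<times> 'b) \<Rightarrow>\<^sub>0 int) set" where
  "tensor_relators R M N =
     {frag_of (m \<oplus>\<^bsub>M\<^esub> m', n) - frag_of (m, n) - frag_of (m', n) | m m' n.
        m \<in> carrier M \<and> m' \<in> carrier M \<and> n \<in> carrier N} \<union>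
     {frag_of (m, n \<oplus>\<^bsub>N\<^esub> n') - frag_of (m, n) - frag_of (m, n') | m n n'.
        m \<in> carrier M \<and> n \<in> carrier N \<and> n' \<in> carrier N} \<union>
     {frag_of (r \<odot>\<^bsub>M\<^esub> m, n) - frag_of (m, r \<odot>\<^bsub>N\<^esub> n) | r m n.
        r \<in> carrier R \<and> m \<in> carrier M \<and> n \<in> carrier N}"

definition tensor_null ::
  "('r, 'm) ring_scheme \<Rightarrow> ('r, 'a, 'p) module_scheme \<Rightarrow> ('r, 'b, 'q) module_scheme
    \<Rightarrow> (('a \<times> 'b) \<Rightarrow>\<^sub>0 int) set" where
  "tensor_null R M N =
     generate (free_Abelian_group (carrier M \<times> carrier N)) (tensor_relators R M N)"

definition tensor_group ::
  "('r, 'm) ring_scheme \<Rightarrow> ('r, 'a, 'p) module_scheme \<Rightarrow> ('r, 'b, 'q) module_scheme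
    \<Rightarrow> ('a, 'b) tens monoid" where
  "tensor_group R M N = free_Abelian_group (carrier M \<times> carrier N) Mod tensor_null R M N"

definition pure_tensor ::
  "('r, 'm) ring_scheme \<Rightarrow> ('r, 'a, 'p) module_scheme \<Rightarrow> ('r, 'b, 'q) module_scheme
    \<Rightarrow> 'a \<Rightarrow> 'b \<Rightarrow> ('a, 'b) tens" where
  "pure_tensor R M N m n =
     tensor_null R M N #>\<^bsub>free_Abelian_group (carrier M \<times> carrier N)\<^esub> frag_of (m, n)"

text \<open>
  The homomorphism \<open>m \<otimes> n \<mapsto> B m n\<close> into the multiplicatively written abelian group \<open>G\<close>
  induced by a balanced biadditive map \<open>B\<close>: the value on a class is read off from any of its
  representatives.
\<close>

definition tensor_lift ::
  "('c, 'm) monoid_scheme \<Rightarrow> ('a \<Rightarrow> 'b \<Rightarrow> 'c) \<Rightarrow> ('a, 'b) tens \<Rightarrow> 'c" where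
  "tensor_lift G B X =
     (THE v. \<exists>x\<in>X. v = (\<Otimes>\<^bsub>G\<^esub>p\<in>Poly_Mapping.keys x.
                          B (fst p) (snd p) [^]\<^bsub>G\<^esub> Poly_Mapping.lookup x p))"

text \<open>
  The product \<open>(m \<otimes> n)(m' \<otimes> n') = mm' \<otimes> nn'\<close> and the unit are meaningful only for \<open>M\<close> and
  \<open>N\<close> algebras over \<open>R\<close>; below they are used for \<open>H \<otimes> H\<close> only.
\<close>

definition tensor ::
  "('r, 'm) ring_scheme \<Rightarrow> ('r, 'a, 'p) module_scheme \<Rightarrow> ('r, 'b, 'q) module_scheme
    \<Rightarrow> ('r, ('a, 'b) tens) module" where
  "tensor R M N = \<lparr>
     carrier = carrier (tensor_group R M N),
     mult = (\<lambda>x y.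
       tensor_lift (tensor_group R M N)
         (\<lambda>m n. tensor_lift (tensor_group R M N)
            (\<lambda>m' n'. pure_tensor R M N (m \<otimes>\<^bsub>M\<^esub> m') (n \<otimes>\<^bsub>N\<^esub> n')) y) x),
     one = pure_tensor R M N \<one>\<^bsub>M\<^esub> \<one>\<^bsub>N\<^esub>,
     ring.zero = \<one>\<^bsub>tensor_group R M N\<^esub>,
     add = mult (tensor_group R M N),
     smult = (\<lambda>r. tensor_lift (tensor_group R M N)
                    (\<lambda>m n. pure_tensor R M N (r \<odot>\<^bsub>M\<^esub> m) n))\<rparr>"


section \<open>The Hopf algebra \<open>H = K[T]\<close>\<close>

definition H_counit :: "('k, 'm) ring_scheme \<Rightarrow> (nat \<Rightarrow> 'k) \<Rightarrow> 'k" where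
  "H_counit K h = eval K K id \<zero>\<^bsub>K\<^esub> h"

type_synonym 'k HH = "(nat \<Rightarrow> 'k, nat \<Rightarrow> 'k) tens"

abbreviation HH_pure :: "('k, 'm) ring_scheme \<Rightarrow> (nat \<Rightarrow> 'k) \<Rightarrow> (nat \<Rightarrow> 'k) \<Rightarrow> 'k HH" where
  "HH_pure K \<equiv> pure_tensor K (UP K) (UP K)"

text \<open>The algebra homomorphism \<open>H \<rightarrow> H \<otimes> H\<close> with \<open>T \<mapsto> T \<otimes> 1 + 1 \<otimes> T\<close>.\<close>

definition H_coproduct :: "('k, 'm) ring_scheme \<Rightarrow> (nat \<Rightarrow> 'k) \<Rightarrow> 'k HH" where
  "H_coproduct K =
     (let HH = tensor K (UP K) (UP K); T = monom (UP K) \<one>\<^bsub>K\<^esub> 1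
      in eval K HH (\<lambda>c. c \<odot>\<^bsub>HH\<^esub> \<one>\<^bsub>HH\<^esub>)
           (HH_pure K T \<one>\<^bsub>UP K\<^esub> \<oplus>\<^bsub>HH\<^esub> HH_pure K \<one>\<^bsub>UP K\<^esub> T))"

text \<open>
  \<open>H \<otimes> H\<close> as a right \<open>H\<close>-module: \<open>(f \<otimes> g) h = f h\<^sub>(\<^sub>1\<^sub>) \<otimes> g h\<^sub>(\<^sub>2\<^sub>)\<close> is the product of
  \<open>f \<otimes> g\<close> and the coproduct of \<open>h\<close> in \<open>H \<otimes> H\<close>.
\<close>

definition HH_module :: "('k, 'm) ring_scheme \<Rightarrow> (nat \<Rightarrow> 'k, 'k HH) module" where
  "HH_module K =
     (let HH = tensor K (UP K) (UP K)
      in ring.extend (ring.truncate HH)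
           (module.fields (\<lambda>h x. x \<otimes>\<^bsub>HH\<^esub> H_coproduct K h)))"


section \<open>Conformal algebras\<close>

text \<open>
  An \<open>H\<close>-conformal algebra is recorded as an \<open>H\<close>-module \<open>C\<close> together with its pseudo-product
  \<open>a * b = \<mu>(a) b\<close> with values in \<open>(H \<otimes> H) \<otimes>\<^sub>H C\<close>.
\<close>

type_synonym ('k, 'c) ptens = "('k HH, 'c) tens"

record ('k, 'c) conformal_algebra = "(nat \<Rightarrow> 'k, 'c) module" +
  pprod :: "'c \<Rightarrow> 'c \<Rightarrow> ('k, 'c) ptens"

text \<open>\<open>ptensor K C f g c\<close> is \<open>(f \<otimes> g) \<otimes>\<^sub>H c\<close>.\<close>

definition ptensor ::
  "('k, 'm) ring_scheme \<Rightarrow> (nat \<Rightarrow> 'k, 'c, 'n) module_scheme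
    \<Rightarrow> (nat \<Rightarrow> 'k) \<Rightarrow> (nat \<Rightarrow> 'k) \<Rightarrow> 'c \<Rightarrow> ('k, 'c) ptens" where
  "ptensor K C f g c = pure_tensor (UP K) (HH_module K) C (HH_pure K f g) c"

definition Cur_module ::
  "('k, 'm) ring_scheme \<Rightarrow> ('k, 'a, 'n) module_scheme
    \<Rightarrow> (nat \<Rightarrow> 'k, (nat \<Rightarrow> 'k, 'a) tens) module" where
  "Cur_module K A =
     ring.extend (ring.truncate (tensor K (UP K) A))
       (module.fields (\<lambda>h. tensor_lift (tensor_group K (UP K) A)
                             (\<lambda>f a. pure_tensor K (UP K) A (h \<otimes>\<^bsub>UP K\<^esub> f) a)))"

definition Cur ::
  "('k, 'm) ring_scheme \<Rightarrow> ('k, 'a, 'n) module_scheme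
    \<Rightarrow> ('k, (nat \<Rightarrow> 'k, 'a) tens) conformal_algebra" where
  "Cur K A =
     (let C = Cur_module K A; P = tensor_group (UP K) (HH_module K) C
      in module.extend C
           (conformal_algebra.fields
             (\<lambda>x y. tensor_lift P
                (\<lambda>f a. tensor_lift P
                   (\<lambda>h b. ptensor K C f h (pure_tensor K (UP K) A \<one>\<^bsub>UP K\<^esub> (a \<otimes>\<^bsub>A\<^esub> b)))
                   y)
                x)))"


section \<open>The dialgebra of a conformal algebra\<close>

record ('k, 'c) dialgebra = "('k, 'c) module" +
  vdash :: "'c \<Rightarrow> 'c \<Rightarrow> 'c"
  dashv :: "'c \<Rightarrow> 'c \<Rightarrow> 'c"

text \<open>\<open>a * b = \<Sum>\<^sub>i (h\<^sub>i \<otimes> 1) \<otimes>\<^sub>H c\<^sub>i\<close>, the sum being over \<open>i < n\<close>.\<close>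

definition pprod_expansion ::
  "('k, 'm) ring_scheme \<Rightarrow> ('k, 'c, 'n) conformal_algebra_scheme \<Rightarrow> 'c \<Rightarrow> 'c
    \<Rightarrow> nat \<Rightarrow> (nat \<Rightarrow> nat \<Rightarrow> 'k) \<Rightarrow> (nat \<Rightarrow> 'c) \<Rightarrow> bool" where
  "pprod_expansion K C a b n h c \<longleftrightarrow>
     h \<in> {..<n} \<rightarrow> carrier (UP K) \<and> c \<in> {..<n} \<rightarrow> carrier C \<and>
     pprod C a b =
       (\<Oplus>\<^bsub>tensor (UP K) (HH_module K) C\<^esub>i\<in>{..<n}. ptensor K C (h i) \<one>\<^bsub>UP K\<^esub> (c i))"

text \<open>Scalars act on the \<open>H\<close>-module \<open>C\<close> through the constant polynomials.\<close>

definition const_smult ::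
  "('k, 'm) ring_scheme \<Rightarrow> (nat \<Rightarrow> 'k, 'c, 'n) module_scheme \<Rightarrow> 'k \<Rightarrow> 'c \<Rightarrow> 'c" where
  "const_smult K C k x = monom (UP K) k 0 \<odot>\<^bsub>C\<^esub> x"

definition conformal_dialgebra ::
  "('k, 'm) ring_scheme \<Rightarrow> ('k, 'c, 'n) conformal_algebra_scheme \<Rightarrow> ('k, 'c) dialgebra" where
  "conformal_dialgebra K C =
     module.extend
       (ring.extend (ring.truncate C) (module.fields (const_smult K C)))
       (dialgebra.fields
         (\<lambda>a b. THE d. \<exists>n h c. pprod_expansion K C a b n h c \<and>
                  d = (\<Oplus>\<^bsub>C\<^esub>i\<in>{..<n}. const_smult K C (H_counit K (h i)) (c i)))
         (\<lambda>a b. THE d. \<exists>n h c. pprod_expansion K C a b n h c \<and>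
                  d = (\<Oplus>\<^bsub>C\<^esub>i\<in>{..<n}. h i \<odot>\<^bsub>C\<^esub> c i)))"

definition current_embedding ::
  "('k, 'm) ring_scheme \<Rightarrow> ('k, 'l, 'n) module_scheme \<Rightarrow> ('k, 'w, 'p) module_scheme
    \<Rightarrow> ('l \<Rightarrow> (nat \<Rightarrow> 'k, 'w \<Rightarrow> 'w) tens) \<Rightarrow> bool" where
  "current_embedding K L W \<rho> \<longleftrightarrow>
     (let D = conformal_dialgebra K (Cur K (End_algebra K W))
      in \<rho> \<in> module_hom K L D \<and> inj_on \<rho> (carrier L) \<and>
         (\<forall>a\<in>carrier L. \<forall>b\<in>carrier L.
            \<rho> (a \<otimes>\<^bsub>L\<^esub> b) = vdash D (\<rho> a) (\<rho> b) \<ominus>\<^bsub>D\<^esub> dashv D (\<rho> b) (\<rho> a)))"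

end

theory Submission
  imports Defs
begin

text \<open>
  Identify the current conformal algebra over an algebra \<open>A\<close> with the polynomials \<open>A[T]\<close>. Its
  dialgebra operations are then \<open>x \<turnstile> y = x(0) y(T)\<close> and \<open>x \<stileturn> y = x(T) y(0)\<close>. For elements
  \<open>\<rho>(a) = a\<^sub>0 + T a\<^sub>1\<close> the required identity therefore splits into \<open>[a b]\<^sub>0 = a\<^sub>0 b\<^sub>0 - b\<^sub>0 a\<^sub>0\<close> and
  \<open>[a b]\<^sub>1 = a\<^sub>0 b\<^sub>1 - b\<^sub>1 a\<^sub>0\<close>. Take \<open>W = K \<oplus> L\<close> and put
  \<open>a\<^sub>0(k, x) = (0, [a x])\<close> and \<open>a\<^sub>1(k, x) = (0, k a)\<close>. The first equation is the Leibniz identity,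
  and in the second one \<open>b\<^sub>1 a\<^sub>0 = 0\<close>, while \<open>a\<^sub>0 b\<^sub>1(k, x) = (0, k [a b])\<close>. Since
  \<open>a\<^sub>1(1, 0) = (0, a)\<close>, the map \<open>\<rho>\<close> is injective, and \<open>W\<close> is finite-dimensional whenever \<open>L\<close> is.

  The description of the two operations is where the work lies, for they are given by a definite
  description over all expansions \<open>a * b = \<Sum>\<^sub>i (h\<^sub>i \<otimes> 1) \<otimes>\<^sub>H c\<^sub>i\<close>. Two facts about
  \<open>(H \<otimes> H) \<otimes>\<^sub>H C\<close> are needed. Every element has such an expansion (\<open>expandable_all\<close>), because
  \<open>(f \<otimes> g) \<Delta>(T) = f T \<otimes> g + f \<otimes> g T\<close> lets one remove the second tensor factor step by step. And
  the sums \<open>\<Sum>\<^sub>i \<epsilon>(h\<^sub>i) c\<^sub>i\<close> and \<open>\<Sum>\<^sub>i h\<^sub>i c\<^sub>i\<close> are independent of the expansion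
  (\<open>fold_PT_expansion\<close>), because they are the values of the maps \<open>(f \<otimes> g) \<otimes>\<^sub>H c \<mapsto> \<epsilon>(f) g c\<close> and
  \<open>(f \<otimes> g) \<otimes>\<^sub>H c \<mapsto> f \<epsilon>(g) c\<close>, which are well defined by the counit laws. Both rest on the
  universal property of the tensor product (\<open>tensor_lift_add_pure\<close>) and on \<open>H \<otimes> H\<close> being a
  commutative ring, which makes the coproduct a ring homomorphism.
\<close>

section \<open>Tensor products\<close>

text \<open>
  The universal property of the free abelian group, with the extension of \<open>f\<close> given by the product
  by which \<open>tensor_lift\<close> reads values off representatives. Enlarging the index set from the support
  of \<open>x\<close> to a common finite set adds trivial factors only, so products can be compared.
\<close>

lemma (in comm_group) free_Abelian_group_extension:
  assumes f: "\<And>p. p \<in> S \<Longrightarrow> f p \<in> carrier G"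
  defines "e \<equiv> \<lambda>x. \<Otimes>p\<in>Poly_Mapping.keys x. f p [^] Poly_Mapping.lookup x p"
  shows "e \<in> hom (free_Abelian_group S) G"
    and "\<And>p. p \<in> S \<Longrightarrow> e (frag_of p) = f p"
proof -
  have over: "e x = (\<Otimes>p\<in>U. f p [^] Poly_Mapping.lookup x p)"
    if "finite U" "U \<subseteq> S" "Poly_Mapping.keys x \<subseteq> U" for x U
    unfolding e_def using that f
    by (intro finprod_mono_neutral_cong_left) (auto simp: in_keys_iff)
  show "e \<in> hom (free_Abelian_group S) G"
  proof (rule homI)
    fix x y
    assume "x \<in> carrier (free_Abelian_group S)" "y \<in> carrier (free_Abelian_group S)"
    then have xy: "Poly_Mapping.keys x \<subseteq> S" "Poly_Mapping.keys y \<subseteq> S"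
      by auto
    define U where "U = Poly_Mapping.keys x \<union> Poly_Mapping.keys y"
    have U: "finite U" "U \<subseteq> S" "Poly_Mapping.keys x \<subseteq> U" "Poly_Mapping.keys y \<subseteq> U"
      "Poly_Mapping.keys (x + y) \<subseteq> U"
      using xy keys_add[of x y] by (auto simp: U_def)
    have "e (x + y) = (\<Otimes>p\<in>U. f p [^] Poly_Mapping.lookup x p \<otimes> f p [^] Poly_Mapping.lookup y p)"
      unfolding over[OF U(1,2,5)] using U f
      by (intro finprod_cong) (auto simp: Poly_Mapping.lookup_add int_pow_mult simp_implies_def subset_iff)
    also have "\<dots> = e x \<otimes> e y"
      unfolding over[OF U(1,2,3)] over[OF U(1,2,4)] using U f
      by (intro finprod_multf) auto
    finally show "e (x \<otimes>\<^bsub>free_Abelian_group S\<^esub> y) = e x \<otimes> e y"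
      by simp
  qed (use f in \<open>auto simp: e_def intro!: finprod_closed\<close>)
  show "e (frag_of p) = f p" if "p \<in> S" for p
    using over[of "{p}" "frag_of p"] that f[OF that] by simp
qed

locale module_pair = M: module R M + N: module R N for R (structure) and M and N
begin

lemma tensor_relators_closed:
  "tensor_relators R M N \<subseteq> carrier (free_Abelian_group (carrier M \<times> carrier N))"
  by (auto simp: tensor_relators_def dest!: subsetD[OF keys_diff])

lemma tensor_null_subgroup:
  "subgroup (tensor_null R M N) (free_Abelian_group (carrier M \<times> carrier N))"
  unfolding tensor_null_def
  by (rule group.generate_is_subgroup[OF group_free_Abelian_group tensor_relators_closed])

lemma tensor_null_normal:
  "tensor_null R M N \<lhd> free_Abelian_group (carrier M \<times> carrier N)"
  using comm_group.normal_iff_subgroup[OF abelian_free_Abelian_group] tensor_null_subgroup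
  by blast

lemma tensor_group_comm_group: "comm_group (tensor_group R M N)"
  unfolding tensor_group_def
  by (rule comm_group.abelian_FactGroup[OF abelian_free_Abelian_group tensor_null_subgroup])

lemma tensor_sel [simp]:
  "carrier (tensor_group R M N) = carrier (tensor R M N)"
  "monoid.mult (tensor_group R M N) = add (tensor R M N)"
  "\<one>\<^bsub>tensor_group R M N\<^esub> = \<zero>\<^bsub>tensor R M N\<^esub>"
  by (auto simp: tensor_def)

lemma tensor_abelian_group: "abelian_group (tensor R M N)"
proof -
  interpret T: comm_group "tensor_group R M N"
    by (rule tensor_group_comm_group)
  show ?thesis
    by (rule abelian_groupI)
      (use T.m_assoc T.m_comm T.l_inv T.inv_closed in \<open>auto simp flip: tensor_sel\<close>)
qed

sublocale T: abelian_group "tensor R M N"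
  by (rule tensor_abelian_group)

lemma carrier_tensor:
  "carrier (tensor R M N) = (\<lambda>x. tensor_null R M N #>\<^bsub>free_Abelian_group (carrier M \<times> carrier N)\<^esub> x) `
     carrier (free_Abelian_group (carrier M \<times> carrier N))"
  by (simp add: tensor_group_def carrier_FactGroup flip: tensor_sel(1))

lemma coset_add:
  assumes "x \<in> carrier (free_Abelian_group (carrier M \<times> carrier N))"
    and "y \<in> carrier (free_Abelian_group (carrier M \<times> carrier N))"
  shows "(tensor_null R M N #>\<^bsub>free_Abelian_group (carrier M \<times> carrier N)\<^esub> x)
      \<oplus>\<^bsub>tensor R M N\<^esub> (tensor_null R M N #>\<^bsub>free_Abelian_group (carrier M \<times> carrier N)\<^esub> y)
    = tensor_null R M N #>\<^bsub>free_Abelian_group (carrier M \<times> carrier N)\<^esub> (x + y)"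
  using normal.rcos_sum[OF tensor_null_normal assms] tensor_sel(2)
  by (simp add: tensor_group_def)

lemma coset_cong:
  assumes "x \<in> carrier (free_Abelian_group (carrier M \<times> carrier N))"
    and "y \<in> carrier (free_Abelian_group (carrier M \<times> carrier N))"
    and "x - y \<in> tensor_relators R M N"
  shows "tensor_null R M N #>\<^bsub>free_Abelian_group (carrier M \<times> carrier N)\<^esub> x
    = tensor_null R M N #>\<^bsub>free_Abelian_group (carrier M \<times> carrier N)\<^esub> y"
proof -
  interpret F: group "free_Abelian_group (carrier M \<times> carrier N)"
    by simp
  have "x - y \<in> tensor_null R M N"
    using assms(3) by (simp add: tensor_null_def generate.incl)
  then have "x \<in> tensor_null R M N #>\<^bsub>free_Abelian_group (carrier M \<times> carrier N)\<^esub> y"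
    by (force simp: r_coset_def)
  then show ?thesis
    using F.repr_independence[OF _ assms(2) tensor_null_subgroup] by metis
qed

lemma relator_add_left:
  "\<lbrakk>m \<in> carrier M; m' \<in> carrier M; n \<in> carrier N\<rbrakk> \<Longrightarrow>
    frag_of (m \<oplus>\<^bsub>M\<^esub> m', n) - (frag_of (m, n) + frag_of (m', n)) \<in> tensor_relators R M N"
  unfolding tensor_relators_def diff_diff_eq[symmetric] by blast

lemma relator_add_right:
  "\<lbrakk>m \<in> carrier M; n \<in> carrier N; n' \<in> carrier N\<rbrakk> \<Longrightarrow>
    frag_of (m, n \<oplus>\<^bsub>N\<^esub> n') - (frag_of (m, n) + frag_of (m, n')) \<in> tensor_relators R M N"
  unfolding tensor_relators_def diff_diff_eq[symmetric] by blast

lemma pure_tensor_closed [simp, intro]: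
  "\<lbrakk>m \<in> carrier M; n \<in> carrier N\<rbrakk> \<Longrightarrow> pure_tensor R M N m n \<in> carrier (tensor R M N)"
  by (simp add: carrier_tensor pure_tensor_def)

lemma pure_tensor_add_left:
  assumes "m \<in> carrier M" "m' \<in> carrier M" "n \<in> carrier N"
  shows "pure_tensor R M N (m \<oplus>\<^bsub>M\<^esub> m') n = pure_tensor R M N m n \<oplus>\<^bsub>tensor R M N\<^esub> pure_tensor R M N m' n"
  using assms unfolding pure_tensor_def
  by (subst coset_add, simp, simp, intro coset_cong)
    (auto dest!: subsetD[OF keys_add] intro!: relator_add_left)

lemma pure_tensor_add_right:
  assumes "m \<in> carrier M" "n \<in> carrier N" "n' \<in> carrier N"
  shows "pure_tensor R M N m (n \<oplus>\<^bsub>N\<^esub> n') = pure_tensor R M N m n \<oplus>\<^bsub>tensor R M N\<^esub> pure_tensor R M N m n'"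
  using assms unfolding pure_tensor_def
  by (subst coset_add, simp, simp, intro coset_cong)
    (auto dest!: subsetD[OF keys_add] intro!: relator_add_right)

lemma pure_tensor_balanced:
  assumes "r \<in> carrier R" "m \<in> carrier M" "n \<in> carrier N"
  shows "pure_tensor R M N (r \<odot>\<^bsub>M\<^esub> m) n = pure_tensor R M N m (r \<odot>\<^bsub>N\<^esub> n)"
  using assms unfolding pure_tensor_def
  by (intro coset_cong) (auto simp: tensor_relators_def)

lemma pure_tensor_zero_left:
  assumes "n \<in> carrier N"
  shows "pure_tensor R M N \<zero>\<^bsub>M\<^esub> n = \<zero>\<^bsub>tensor R M N\<^esub>"
  using pure_tensor_add_left[of "\<zero>\<^bsub>M\<^esub>" "\<zero>\<^bsub>M\<^esub>" n] assms by simp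

lemma pure_tensor_zero_right:
  assumes "m \<in> carrier M"
  shows "pure_tensor R M N m \<zero>\<^bsub>N\<^esub> = \<zero>\<^bsub>tensor R M N\<^esub>"
  using pure_tensor_add_right[of m "\<zero>\<^bsub>N\<^esub>" "\<zero>\<^bsub>N\<^esub>"] assms by simp

lemma pure_tensor_minus_left:
  assumes "m \<in> carrier M" "n \<in> carrier N"
  shows "pure_tensor R M N (\<ominus>\<^bsub>M\<^esub> m) n = \<ominus>\<^bsub>tensor R M N\<^esub> pure_tensor R M N m n"
  using pure_tensor_add_left[of "\<ominus>\<^bsub>M\<^esub> m" m n] assms
  by (simp add: M.M.l_neg pure_tensor_zero_left T.minus_equality)

text \<open>
  Sums of pure tensors exhaust the tensor product, because negatives of pure tensors are pure:
  \<open>- (m \<otimes> n) = (- m) \<otimes> n\<close>. The induction on the free abelian group runs through differences, so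
  the property is carried along for an element and for its negative.
\<close>

lemma tensor_induct [consumes 1, case_names pure add]:
  assumes X: "X \<in> carrier (tensor R M N)"
    and pure: "\<And>m n. \<lbrakk>m \<in> carrier M; n \<in> carrier N\<rbrakk> \<Longrightarrow> P (pure_tensor R M N m n)"
    and add: "\<And>x y. \<lbrakk>x \<in> carrier (tensor R M N); y \<in> carrier (tensor R M N); P x; P y\<rbrakk>
      \<Longrightarrow> P (x \<oplus>\<^bsub>tensor R M N\<^esub> y)"
  shows "P X"
proof -
  let ?F = "free_Abelian_group (carrier M \<times> carrier N)"
  let ?c = "\<lambda>x. tensor_null R M N #>\<^bsub>?F\<^esub> x"
  have cl: "?c x \<in> carrier (tensor R M N)" if "Poly_Mapping.keys x \<subseteq> carrier M \<times> carrier N" for x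
    using that by (auto simp: carrier_tensor)
  obtain x where x: "Poly_Mapping.keys x \<subseteq> carrier M \<times> carrier N" "X = ?c x"
    using X by (auto simp: carrier_tensor)
  have zero: "?c 0 = pure_tensor R M N \<zero>\<^bsub>M\<^esub> \<zero>\<^bsub>N\<^esub>"
  proof -
    have "?c 0 \<oplus>\<^bsub>tensor R M N\<^esub> ?c 0 = ?c 0"
      using coset_add[of 0 0] by simp
    then have "?c 0 = \<zero>\<^bsub>tensor R M N\<^esub>"
      using cl[of 0] by simp
    then show ?thesis
      by (simp add: pure_tensor_zero_left)
  qed
  have neg: "?c (- y) = \<ominus>\<^bsub>tensor R M N\<^esub> ?c y" if "Poly_Mapping.keys y \<subseteq> carrier M \<times> carrier N" for y
    using coset_add[of "- y" y] that cl[of y] cl[of "- y"] zero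
    by (simp add: pure_tensor_zero_left T.minus_equality)
  have "P (?c x) \<and> P (?c (- x))"
  proof (rule free_Abelian_group_induct[OF x(1), where P = "\<lambda>x. P (?c x) \<and> P (?c (- x))"])
    show "P (?c 0) \<and> P (?c (- 0))"
      using pure[of "\<zero>\<^bsub>M\<^esub>" "\<zero>\<^bsub>N\<^esub>"] zero by simp
  next
    fix x y
    assume h: "Poly_Mapping.keys x \<subseteq> carrier M \<times> carrier N" "Poly_Mapping.keys y \<subseteq> carrier M \<times> carrier N"
      "P (?c x) \<and> P (?c (- x))" "P (?c y) \<and> P (?c (- y))"
    have "?c (x - y) = ?c x \<oplus>\<^bsub>tensor R M N\<^esub> ?c (- y)" "?c (- (x - y)) = ?c y \<oplus>\<^bsub>tensor R M N\<^esub> ?c (- x)"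
      using coset_add[of x "- y"] coset_add[of y "- x"] h by simp_all
    then show "P (?c (x - y)) \<and> P (?c (- (x - y)))"
      using add[of "?c x" "?c (- y)"] add[of "?c y" "?c (- x)"] h by (simp add: cl)
  next
    fix p
    assume "p \<in> carrier M \<times> carrier N"
    then obtain m n where mn: "p = (m, n)" "m \<in> carrier M" "n \<in> carrier N"
      by auto
    have "?c (- frag_of p) = pure_tensor R M N (\<ominus>\<^bsub>M\<^esub> m) n"
      using neg[of "frag_of p"] mn pure_tensor_minus_left[of m n] by (simp add: pure_tensor_def)
    moreover have "?c (frag_of p) = pure_tensor R M N m n"
      by (simp add: pure_tensor_def mn)
    ultimately show "P (?c (frag_of p)) \<and> P (?c (- frag_of p))"
      using pure mn by simp
  qed
  then show ?thesis
    using x by simp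
qed

end

text \<open>
  \<open>G\<close> is the additive group of \<open>X\<close>, written multiplicatively. It is a parameter of its own since
  it occurs both as \<open>add_monoid X\<close> and, for tensor products \<open>X\<close>, as a quotient group, and these
  two are records of different types.
\<close>

locale balanced_map = module_pair R M N + X: abelian_group X
  for R (structure) and M and N and X and G and B +
  assumes G: "carrier G = carrier X" "monoid.mult G = add X" "\<one>\<^bsub>G\<^esub> = \<zero>\<^bsub>X\<^esub>"
    and B_closed: "\<lbrakk>m \<in> carrier M; n \<in> carrier N\<rbrakk> \<Longrightarrow> B m n \<in> carrier X"
    and B_add_left: "\<lbrakk>m \<in> carrier M; m' \<in> carrier M; n \<in> carrier N\<rbrakk>
      \<Longrightarrow> B (m \<oplus>\<^bsub>M\<^esub> m') n = B m n \<oplus>\<^bsub>X\<^esub> B m' n"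
    and B_add_right: "\<lbrakk>m \<in> carrier M; n \<in> carrier N; n' \<in> carrier N\<rbrakk>
      \<Longrightarrow> B m (n \<oplus>\<^bsub>N\<^esub> n') = B m n \<oplus>\<^bsub>X\<^esub> B m n'"
    and B_balanced: "\<lbrakk>r \<in> carrier R; m \<in> carrier M; n \<in> carrier N\<rbrakk>
      \<Longrightarrow> B (r \<odot>\<^bsub>M\<^esub> m) n = B m (r \<odot>\<^bsub>N\<^esub> n)"
begin

lemma comm_group_G: "comm_group G"
  by (rule comm_groupI) (auto simp: G X.a_ac intro: bexI[of _ "\<ominus>\<^bsub>X\<^esub> _"] X.l_neg)

text \<open>
  The universal property of the tensor product: the extension of \<open>B\<close> to the free abelian group
  kills the relators, as \<open>B\<close> is biadditive and balanced. Hence it kills the subgroup generated by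
  them and is constant on each coset, so that reading a value off an arbitrary representative is
  meaningful.
\<close>

lemma tensor_lift_add_pure:
  shows tensor_lift_closed [simp]: "x \<in> carrier (tensor R M N) \<Longrightarrow> tensor_lift G B x \<in> carrier X"
    and tensor_lift_add: "\<lbrakk>x \<in> carrier (tensor R M N); y \<in> carrier (tensor R M N)\<rbrakk>
      \<Longrightarrow> tensor_lift G B (x \<oplus>\<^bsub>tensor R M N\<^esub> y) = tensor_lift G B x \<oplus>\<^bsub>X\<^esub> tensor_lift G B y"
    and tensor_lift_pure [simp]: "\<lbrakk>m \<in> carrier M; n \<in> carrier N\<rbrakk>
      \<Longrightarrow> tensor_lift G B (pure_tensor R M N m n) = B m n"
proof -
  interpret G: comm_group G
    by (rule comm_group_G)
  let ?F = "free_Abelian_group (carrier M \<times> carrier N)"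
  let ?c = "\<lambda>x. tensor_null R M N #>\<^bsub>?F\<^esub> x"
  define e where "e = (\<lambda>x :: ('c \<times> 'e) \<Rightarrow>\<^sub>0 int. \<Otimes>\<^bsub>G\<^esub>p\<in>Poly_Mapping.keys x.
    B (fst p) (snd p) [^]\<^bsub>G\<^esub> Poly_Mapping.lookup x p)"
  have e: "e \<in> hom ?F G" "\<And>m n. \<lbrakk>m \<in> carrier M; n \<in> carrier N\<rbrakk> \<Longrightarrow> e (frag_of (m, n)) = B m n"
    using G.free_Abelian_group_extension[of "carrier M \<times> carrier N" "\<lambda>p. B (fst p) (snd p)"]
    by (auto simp: e_def B_closed G)
  interpret e: group_hom ?F G e
    by (simp add: group_hom_def group_hom_axioms_def e(1) G.is_group)
  have e_diff: "e (x - y) = e x \<otimes>\<^bsub>G\<^esub> inv\<^bsub>G\<^esub> e y" if "x \<in> carrier ?F" "y \<in> carrier ?F" for x y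
    using e.hom_mult[of x "- y"] e.hom_inv[of y] that by simp
  have "tensor_relators R M N \<subseteq> kernel ?F G e"
  proof
    fix z
    assume z: "z \<in> tensor_relators R M N"
    have *: "(a \<oplus>\<^bsub>X\<^esub> b) \<otimes>\<^bsub>G\<^esub> inv\<^bsub>G\<^esub> a \<otimes>\<^bsub>G\<^esub> inv\<^bsub>G\<^esub> b = \<one>\<^bsub>G\<^esub>" if "a \<in> carrier G" "b \<in> carrier G" for a b
      using that by (metis G(2) G.inv_closed G.inv_solve_right G.l_one G.m_closed G.m_comm G.m_assoc G.r_inv)
    have "e z = \<one>\<^bsub>G\<^esub>"
      using z unfolding tensor_relators_def
    proof (elim UnE CollectE exE conjE)
      fix m m' n
      assume h: "z = frag_of (m \<oplus>\<^bsub>M\<^esub> m', n) - frag_of (m, n) - frag_of (m', n)"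
        "m \<in> carrier M" "m' \<in> carrier M" "n \<in> carrier N"
      have "frag_of (m \<oplus>\<^bsub>M\<^esub> m', n) - frag_of (m, n) \<in> carrier ?F"
        using h by (auto dest!: subsetD[OF keys_diff])
      then show ?thesis
        using h by (simp add: e_diff e(2) B_add_left B_closed G(1) * del: carrier_free_Abelian_group_iff)
    next
      fix m n n'
      assume h: "z = frag_of (m, n \<oplus>\<^bsub>N\<^esub> n') - frag_of (m, n) - frag_of (m, n')"
        "m \<in> carrier M" "n \<in> carrier N" "n' \<in> carrier N"
      have "frag_of (m, n \<oplus>\<^bsub>N\<^esub> n') - frag_of (m, n) \<in> carrier ?F"
        using h by (auto dest!: subsetD[OF keys_diff])
      then show ?thesis
        using h by (simp add: e_diff e(2) B_add_right B_closed G(1) * del: carrier_free_Abelian_group_iff)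
    next
      fix r m n
      assume h: "z = frag_of (r \<odot>\<^bsub>M\<^esub> m, n) - frag_of (m, r \<odot>\<^bsub>N\<^esub> n)"
        "r \<in> carrier R" "m \<in> carrier M" "n \<in> carrier N"
      then show ?thesis
        by (simp add: e_diff e(2) B_balanced B_closed G(1))
    qed
    then show "z \<in> kernel ?F G e"
      using subsetD[OF tensor_relators_closed z] by (simp add: kernel_def del: carrier_free_Abelian_group_iff)
  qed
  then have null: "tensor_null R M N \<subseteq> kernel ?F G e"
    unfolding tensor_null_def
    by (rule group.generate_subgroup_incl[OF group_free_Abelian_group _ e.subgroup_kernel])
  have lift: "tensor_lift G B (?c x) = e x" if x: "x \<in> carrier ?F" for x
  proof -
    have const: "e y = e x" if y: "y \<in> ?c x" for y
    proof -
      obtain n where n: "n \<in> tensor_null R M N" "y = n + x"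
        using y by (auto simp: r_coset_def)
      then have "n \<in> kernel ?F G e"
        using null by blast
      then have "n \<in> carrier ?F" "e n = \<one>\<^bsub>G\<^esub>"
        by (simp_all add: kernel_def)
      then show ?thesis
        using e.hom_mult[of n x] e.hom_closed[OF x] x n(2) by simp
    qed
    have self: "x \<in> ?c x"
      using group.rcos_self[OF group_free_Abelian_group x tensor_null_subgroup] .
    have "tensor_lift G B (?c x) = (THE v. \<exists>y\<in>?c x. v = e y)"
      unfolding tensor_lift_def e_def ..
    also have "\<dots> = e x"
      by (rule the_equality) (use self const in blast)+
    finally show ?thesis .
  qed
  show "tensor_lift G B x \<in> carrier X" if "x \<in> carrier (tensor R M N)" for x
    using that lift e.hom_closed by (auto simp: carrier_tensor G simp del: carrier_free_Abelian_group_iff)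
  show "tensor_lift G B (x \<oplus>\<^bsub>tensor R M N\<^esub> y) = tensor_lift G B x \<oplus>\<^bsub>X\<^esub> tensor_lift G B y"
    if xy: "x \<in> carrier (tensor R M N)" "y \<in> carrier (tensor R M N)" for x y
  proof -
    obtain a b where ab: "a \<in> carrier ?F" "x = ?c a" "b \<in> carrier ?F" "y = ?c b"
      using xy by (auto simp: carrier_tensor)
    have "a + b \<in> carrier ?F"
      using group.is_monoid[OF group_free_Abelian_group] ab
      by (metis mult_free_Abelian_group monoid.m_closed)
    then show ?thesis
      using coset_add[OF ab(1,3)] lift ab e.hom_mult[OF ab(1,3)] by (simp add: G)
  qed
  show "tensor_lift G B (pure_tensor R M N m n) = B m n" if "m \<in> carrier M" "n \<in> carrier N" for m n
    using lift[of "frag_of (m, n)"] that by (simp add: pure_tensor_def e(2))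
qed

end

text \<open>
  Products of tensors are nested lifts: \<open>m\<close> and \<open>n\<close> are extracted from the first factor, and for
  these fixed, \<open>m'\<close> and \<open>n'\<close> from the second.
\<close>

locale balanced_bimap =
  P: module_pair R M N + Q: module_pair R' M' N' + X: abelian_group X
  for R M N R' M' N' X and G and B +
  assumes left: "\<lbrakk>m' \<in> carrier M'; n' \<in> carrier N'\<rbrakk>
      \<Longrightarrow> balanced_map R M N X G (\<lambda>m n. B m n m' n')"
    and right: "\<lbrakk>m \<in> carrier M; n \<in> carrier N\<rbrakk> \<Longrightarrow> balanced_map R' M' N' X G (B m n)"
begin

text \<open>
  The inner lift is balanced in \<open>(m, n)\<close> for each \<open>y\<close>, since it is for pure \<open>y\<close> by assumption and
  both sides of each law are additive in \<open>y\<close>. This makes the outer lift well defined.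
\<close>

lemma balanced_inner_lift:
  assumes "y \<in> carrier (tensor R' M' N')"
  shows "balanced_map R M N X G (\<lambda>m n. tensor_lift G (B m n) y)"
proof -
  have G: "carrier G = carrier X" "monoid.mult G = add X" "\<one>\<^bsub>G\<^esub> = \<zero>\<^bsub>X\<^esub>"
    using balanced_map.G[OF left[of "\<zero>\<^bsub>M'\<^esub>" "\<zero>\<^bsub>N'\<^esub>"]] by auto
  note pure = balanced_map.tensor_lift_pure[OF right]
  note lift_add = balanced_map.tensor_lift_add[OF right]
  note closed = balanced_map.tensor_lift_closed[OF right]
  show ?thesis
  proof (unfold_locales; (rule G)?)
    show "tensor_lift G (B m n) y \<in> carrier X" if "m \<in> carrier M" "n \<in> carrier N" for m n
      using closed[OF that assms] .
    show "tensor_lift G (B (m \<oplus>\<^bsub>M\<^esub> m') n) y = tensor_lift G (B m n) y \<oplus>\<^bsub>X\<^esub> tensor_lift G (B m' n) y"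
      if h: "m \<in> carrier M" "m' \<in> carrier M" "n \<in> carrier N" for m m' n
      using assms
    proof (induction rule: Q.tensor_induct)
      case (pure a b)
      then show ?case
        using h by (simp add: balanced_map.tensor_lift_pure[OF right] balanced_map.B_add_left[OF left])
    next
      case (add x y)
      then show ?case
        using h by (simp add: lift_add closed X.a_ac)
    qed
    show "tensor_lift G (B m (n \<oplus>\<^bsub>N\<^esub> n')) y = tensor_lift G (B m n) y \<oplus>\<^bsub>X\<^esub> tensor_lift G (B m n') y"
      if h: "m \<in> carrier M" "n \<in> carrier N" "n' \<in> carrier N" for m n n'
      using assms
    proof (induction rule: Q.tensor_induct)
      case (pure a b)
      then show ?case
        using h by (simp add: balanced_map.tensor_lift_pure[OF right] balanced_map.B_add_right[OF left])
    next
      case (add x y)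
      then show ?case
        using h by (simp add: lift_add closed X.a_ac)
    qed
    show "tensor_lift G (B (r \<odot>\<^bsub>M\<^esub> m) n) y = tensor_lift G (B m (r \<odot>\<^bsub>N\<^esub> n)) y"
      if h: "r \<in> carrier R" "m \<in> carrier M" "n \<in> carrier N" for r m n
      using assms
    proof (induction rule: Q.tensor_induct)
      case (pure a b)
      then show ?case
        using h by (simp add: balanced_map.tensor_lift_pure[OF right] balanced_map.B_balanced[OF left])
    next
      case (add x y)
      then show ?case
        using h by (simp add: lift_add closed)
    qed
  qed
qed

abbreviation bilift where
  "bilift x y \<equiv> tensor_lift G (\<lambda>m n. tensor_lift G (B m n) y) x"

lemma bilift_closed [simp]:
  "\<lbrakk>x \<in> carrier (tensor R M N); y \<in> carrier (tensor R' M' N')\<rbrakk> \<Longrightarrow> bilift x y \<in> carrier X"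
  by (rule balanced_map.tensor_lift_closed[OF balanced_inner_lift])

lemma bilift_pure_left:
  "\<lbrakk>m \<in> carrier M; n \<in> carrier N; y \<in> carrier (tensor R' M' N')\<rbrakk>
    \<Longrightarrow> bilift (pure_tensor R M N m n) y = tensor_lift G (B m n) y"
  by (rule balanced_map.tensor_lift_pure[OF balanced_inner_lift])

lemma bilift_pure [simp]:
  "\<lbrakk>m \<in> carrier M; n \<in> carrier N; m' \<in> carrier M'; n' \<in> carrier N'\<rbrakk>
    \<Longrightarrow> bilift (pure_tensor R M N m n) (pure_tensor R' M' N' m' n') = B m n m' n'"
  by (simp add: bilift_pure_left balanced_map.tensor_lift_pure[OF right])

lemma bilift_add_left:
  "\<lbrakk>x \<in> carrier (tensor R M N); x' \<in> carrier (tensor R M N); y \<in> carrier (tensor R' M' N')\<rbrakk>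
    \<Longrightarrow> bilift (x \<oplus>\<^bsub>tensor R M N\<^esub> x') y = bilift x y \<oplus>\<^bsub>X\<^esub> bilift x' y"
  by (rule balanced_map.tensor_lift_add[OF balanced_inner_lift])

lemma bilift_add_right:
  assumes "x \<in> carrier (tensor R M N)" "y \<in> carrier (tensor R' M' N')" "y' \<in> carrier (tensor R' M' N')"
  shows "bilift x (y \<oplus>\<^bsub>tensor R' M' N'\<^esub> y') = bilift x y \<oplus>\<^bsub>X\<^esub> bilift x y'"
  using assms(1)
proof (induction rule: P.tensor_induct)
  case (pure m n)
  then show ?case
    using assms by (simp add: bilift_pure_left balanced_map.tensor_lift_add[OF right])
next
  case (add a b)
  then show ?case
    using assms by (simp add: bilift_add_left X.a_ac)
qed

end

lemma abelian_group_cong: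
  assumes "abelian_group X"
    and "carrier Y = carrier X" "add Y = add X" "\<zero>\<^bsub>Y\<^esub> = \<zero>\<^bsub>X\<^esub>"
  shows "abelian_group Y"
  by (rule abelian_groupI) (use assms abelian_groupE[OF assms(1)] in simp_all)

section \<open>The tensor product of two commutative algebras\<close>

locale algebra_pair = M: algebra R M + N: algebra R N for R (structure) and M and N
begin

sublocale module_pair R M N ..

lemma mult_balanced_map:
  assumes "m' \<in> carrier M" "n' \<in> carrier N"
  shows "balanced_map R M N (tensor R M N) (tensor_group R M N)
    (\<lambda>m n. pure_tensor R M N (m \<otimes>\<^bsub>M\<^esub> m') (n \<otimes>\<^bsub>N\<^esub> n'))"
  by unfold_locales
    (use assms in \<open>simp_all add: M.l_distr N.l_distr pure_tensor_add_left pure_tensor_add_right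
       M.smult_assoc2 N.smult_assoc2 pure_tensor_balanced\<close>)

lemma mult_balanced_bimap:
  "balanced_bimap R M N R M N (tensor R M N) (tensor_group R M N)
     (\<lambda>m n m' n'. pure_tensor R M N (m \<otimes>\<^bsub>M\<^esub> m') (n \<otimes>\<^bsub>N\<^esub> n'))"
proof (intro balanced_bimap.intro balanced_bimap_axioms.intro module_pair_axioms tensor_abelian_group)
  fix m n
  assume h: "m \<in> carrier M" "n \<in> carrier N"
  show "balanced_map R M N (tensor R M N) (tensor_group R M N)
      (\<lambda>m' n'. pure_tensor R M N (m \<otimes>\<^bsub>M\<^esub> m') (n \<otimes>\<^bsub>N\<^esub> n'))"
    using mult_balanced_map[OF h] h
    by (simp add: balanced_map_def balanced_map_axioms_def M.m_comm N.m_comm)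
qed (rule mult_balanced_map)

lemma tensor_mult_eq:
  "x \<otimes>\<^bsub>tensor R M N\<^esub> y = tensor_lift (tensor_group R M N)
     (\<lambda>m n. tensor_lift (tensor_group R M N)
        (\<lambda>m' n'. pure_tensor R M N (m \<otimes>\<^bsub>M\<^esub> m') (n \<otimes>\<^bsub>N\<^esub> n')) y) x"
  by (simp add: tensor_def del: tensor_sel)

lemmas tensor_mult_closed [simp] =
  balanced_bimap.bilift_closed[OF mult_balanced_bimap, folded tensor_mult_eq]

lemmas tensor_mult_pure [simp] =
  balanced_bimap.bilift_pure[OF mult_balanced_bimap, folded tensor_mult_eq]

lemmas tensor_mult_add_left =
  balanced_bimap.bilift_add_left[OF mult_balanced_bimap, folded tensor_mult_eq]

lemmas tensor_mult_add_right =
  balanced_bimap.bilift_add_right[OF mult_balanced_bimap, folded tensor_mult_eq]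

lemma tensor_one: "\<one>\<^bsub>tensor R M N\<^esub> = pure_tensor R M N \<one>\<^bsub>M\<^esub> \<one>\<^bsub>N\<^esub>"
  by (simp add: tensor_def del: tensor_sel)

lemma tensor_mult_comm:
  assumes "x \<in> carrier (tensor R M N)" "y \<in> carrier (tensor R M N)"
  shows "x \<otimes>\<^bsub>tensor R M N\<^esub> y = y \<otimes>\<^bsub>tensor R M N\<^esub> x"
  using assms(1)
proof (induction rule: tensor_induct)
  case (pure m n)
  show ?case
    using assms(2) pure
  proof (induction rule: tensor_induct)
    case (pure m' n')
    then show ?case
      by (simp add: M.m_comm N.m_comm)
  next
    case (add x y)
    then show ?case
      by (simp add: tensor_mult_add_left tensor_mult_add_right)
  qed
next
  case (add x y)
  then show ?case
    using assms(2) by (simp add: tensor_mult_add_left tensor_mult_add_right)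
qed

lemma tensor_mult_assoc:
  assumes "x \<in> carrier (tensor R M N)" "y \<in> carrier (tensor R M N)" "z \<in> carrier (tensor R M N)"
  shows "x \<otimes>\<^bsub>tensor R M N\<^esub> y \<otimes>\<^bsub>tensor R M N\<^esub> z = x \<otimes>\<^bsub>tensor R M N\<^esub> (y \<otimes>\<^bsub>tensor R M N\<^esub> z)"
  using assms(1)
proof (induction rule: tensor_induct)
  case (pure m n)
  show ?case
    using assms(2) pure
  proof (induction rule: tensor_induct)
    case (pure m' n')
    show ?case
      using assms(3) pure
    proof (induction rule: tensor_induct)
      case (pure m'' n'')
      then show ?case
        by (simp add: M.m_assoc N.m_assoc)
    next
      case (add x y)
      then show ?case
        by (simp add: tensor_mult_add_right)
    qed
  next
    case (add x y)
    then show ?case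
      using assms(3) by (simp add: tensor_mult_add_left tensor_mult_add_right)
  qed
next
  case (add x y)
  then show ?case
    using assms by (simp add: tensor_mult_add_left)
qed

lemma tensor_cring: "cring (tensor R M N)"
proof (rule cringI)
  show "comm_monoid (tensor R M N)"
  proof (rule comm_monoidI)
    show "\<one>\<^bsub>tensor R M N\<^esub> \<otimes>\<^bsub>tensor R M N\<^esub> x = x" if "x \<in> carrier (tensor R M N)" for x
      using that
    proof (induction rule: tensor_induct)
      case (pure m n)
      then show ?case
        by (simp add: tensor_one)
    next
      case (add x y)
      then show ?case
        by (simp add: tensor_one tensor_mult_add_right)
    qed
  qed (simp_all add: tensor_one tensor_mult_assoc, rule tensor_mult_comm)
qed (simp_all add: tensor_abelian_group tensor_mult_add_left)

lemma smult_balanced_map: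
  assumes "r \<in> carrier R"
  shows "balanced_map R M N (tensor R M N) (tensor_group R M N)
    (\<lambda>m n. pure_tensor R M N (r \<odot>\<^bsub>M\<^esub> m) n)"
proof unfold_locales
  fix s m n
  assume h: "s \<in> carrier R" "m \<in> carrier M" "n \<in> carrier N"
  have "pure_tensor R M N (r \<odot>\<^bsub>M\<^esub> (s \<odot>\<^bsub>M\<^esub> m)) n = pure_tensor R M N (s \<odot>\<^bsub>M\<^esub> (r \<odot>\<^bsub>M\<^esub> m)) n"
    using assms h by (metis M.smult_assoc1 M.R.m_comm)
  then show "pure_tensor R M N (r \<odot>\<^bsub>M\<^esub> (s \<odot>\<^bsub>M\<^esub> m)) n = pure_tensor R M N (r \<odot>\<^bsub>M\<^esub> m) (s \<odot>\<^bsub>N\<^esub> n)"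
    using pure_tensor_balanced[OF h(1) M.smult_closed[OF assms h(2)] h(3)] by simp
qed (use assms in \<open>simp_all add: M.smult_r_distr pure_tensor_add_left pure_tensor_add_right\<close>)

lemma tensor_smult_pure:
  assumes "r \<in> carrier R" "m \<in> carrier M" "n \<in> carrier N"
  shows "r \<odot>\<^bsub>tensor R M N\<^esub> pure_tensor R M N m n = pure_tensor R M N (r \<odot>\<^bsub>M\<^esub> m) n"
  using balanced_map.tensor_lift_pure[OF smult_balanced_map[OF assms(1)] assms(2,3)]
  by (simp add: tensor_def del: tensor_sel)

lemma tensor_unit_hom: "(\<lambda>r. r \<odot>\<^bsub>tensor R M N\<^esub> \<one>\<^bsub>tensor R M N\<^esub>) \<in> ring_hom R (tensor R M N)"
  by (rule ring_hom_memI)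
    (auto simp: tensor_one tensor_smult_pure M.smult_l_distr pure_tensor_add_left
      M.smult_assoc1 M.smult_assoc2)

end


section \<open>The Hopf algebra of polynomials\<close>

locale polynomial_hopf_algebra = K: cring K for K (structure)
begin

sublocale U: UP_cring K "UP K"
  by unfold_locales simp_all

abbreviation HH where "HH \<equiv> tensor K (UP K) (UP K)"
abbreviation T where "T \<equiv> monom (UP K) \<one> (Suc 0)"
abbreviation const where "const c \<equiv> monom (UP K) c 0"

sublocale HH: algebra_pair K "UP K" "UP K"
  by (intro algebra_pair.intro U.UP_algebra)

sublocale HH: cring HH
  by (rule HH.tensor_cring)

lemma smult_eq_const_mult:
  "\<lbrakk>c \<in> carrier K; f \<in> carrier (UP K)\<rbrakk> \<Longrightarrow> c \<odot>\<^bsub>UP K\<^esub> f = const c \<otimes>\<^bsub>UP K\<^esub> f"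
  by (simp add: U.monom_mult_is_smult)

text \<open>
  As a \<open>K\<close>-algebra, \<open>K[T]\<close> is generated by \<open>T\<close>.
\<close>

lemma UP_induct [consumes 1, case_names const T add]:
  assumes g: "g \<in> carrier (UP K)"
    and const: "\<And>c. c \<in> carrier K \<Longrightarrow> P (const c)"
    and T: "\<And>f. \<lbrakk>f \<in> carrier (UP K); P f\<rbrakk> \<Longrightarrow> P (f \<otimes>\<^bsub>UP K\<^esub> T)"
    and add: "\<And>f f'. \<lbrakk>f \<in> carrier (UP K); f' \<in> carrier (UP K); P f; P f'\<rbrakk> \<Longrightarrow> P (f \<oplus>\<^bsub>UP K\<^esub> f')"
  shows "P g"
proof -
  have monom: "P (monom (UP K) c n)" if "c \<in> carrier K" for c n
  proof (induction n)
    case (Suc n)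
    have "monom (UP K) c (Suc n) = monom (UP K) c n \<otimes>\<^bsub>UP K\<^esub> T"
      using U.monom_mult[of c \<one> n 1] that by (simp del: U.monom_mult)
    then show ?case
      using T[OF _ Suc] that by simp
  qed (use const that in blast)
  have c: "coeff (UP K) g i \<in> carrier K" for i
    using g by simp
  have "P (\<Oplus>\<^bsub>UP K\<^esub>i\<in>{..n}. monom (UP K) (coeff (UP K) g i) i)" for n
  proof (induction n)
    case 0
    show ?case
      using monom[OF c] U.finsum_0[of "\<lambda>i. monom (UP K) (coeff (UP K) g i) i"] c by simp
  next
    case (Suc n)
    have "(\<Oplus>\<^bsub>UP K\<^esub>i\<in>{..n}. monom (UP K) (coeff (UP K) g i) i) \<in> carrier (UP K)"
      using c by (intro U.finsum_closed) auto
    from add[OF _ this monom[OF c] Suc] show ?case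
      using c by (subst U.finsum_Suc) auto
  qed
  then show ?thesis
    using U.up_repr[OF g] by metis
qed

lemma H_coproduct_eq:
  "H_coproduct K = eval K HH (\<lambda>c. c \<odot>\<^bsub>HH\<^esub> \<one>\<^bsub>HH\<^esub>)
     (HH_pure K T \<one>\<^bsub>UP K\<^esub> \<oplus>\<^bsub>HH\<^esub> HH_pure K \<one>\<^bsub>UP K\<^esub> T)"
  by (simp add: H_coproduct_def Let_def)

text \<open>
  Since \<open>H \<otimes> H\<close> is a commutative ring containing an image of \<open>K\<close>, evaluation at \<open>T \<otimes> 1 + 1 \<otimes> T\<close> is
  governed by the universal property of \<open>K[T]\<close>; this is what makes the coproduct a ring
  homomorphism.
\<close>

lemma coproduct_universal:
  "UP_pre_univ_prop K HH (\<lambda>c. c \<odot>\<^bsub>HH\<^esub> \<one>\<^bsub>HH\<^esub>)"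
  by (intro UP_pre_univ_prop.intro ring_hom_cringI K.is_cring HH.is_cring HH.tensor_unit_hom
      U.UP_cring_axioms)

lemma coproduct_ring_hom: "H_coproduct K \<in> ring_hom (UP K) HH"
  unfolding H_coproduct_eq
  by (intro UP_pre_univ_prop.eval_ring_hom[OF coproduct_universal]) simp

lemma coproduct_T: "H_coproduct K T = HH_pure K T \<one>\<^bsub>UP K\<^esub> \<oplus>\<^bsub>HH\<^esub> HH_pure K \<one>\<^bsub>UP K\<^esub> T"
  unfolding H_coproduct_eq
  by (intro UP_pre_univ_prop.eval_monom1[OF coproduct_universal, unfolded One_nat_def]) simp

lemma coproduct_const:
  assumes "c \<in> carrier K"
  shows "H_coproduct K (const c) = HH_pure K (const c) \<one>\<^bsub>UP K\<^esub>"
proof -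
  have "H_coproduct K (const c) = c \<odot>\<^bsub>HH\<^esub> \<one>\<^bsub>HH\<^esub>"
    unfolding H_coproduct_eq
    by (intro UP_pre_univ_prop.eval_const[OF coproduct_universal]) (use assms in simp_all)
  then show ?thesis
    using assms by (simp add: HH.tensor_one HH.tensor_smult_pure smult_eq_const_mult)
qed

lemmas coproduct_hom [simp] =
  ring_hom_closed[OF coproduct_ring_hom] ring_hom_add[OF coproduct_ring_hom]
  ring_hom_mult[OF coproduct_ring_hom] ring_hom_one[OF coproduct_ring_hom]

lemma counit_universal: "UP_pre_univ_prop K K id"
  by (intro UP_pre_univ_prop.intro ring_hom_cringI K.is_cring U.UP_cring_axioms)
    (simp add: ring_hom_def)

lemma counit_ring_hom: "H_counit K \<in> ring_hom (UP K) K"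
  unfolding H_counit_def[abs_def]
  using UP_pre_univ_prop.eval_ring_hom[OF counit_universal, of \<zero>] by simp

lemma counit_T [simp]: "H_counit K T = \<zero>"
  unfolding H_counit_def by (intro UP_pre_univ_prop.eval_monom1[OF counit_universal, unfolded One_nat_def]) simp

lemma counit_const [simp]: "c \<in> carrier K \<Longrightarrow> H_counit K (const c) = c"
  unfolding H_counit_def using UP_pre_univ_prop.eval_const[OF counit_universal, of \<zero> c] by simp

lemmas counit_hom [simp] =
  ring_hom_closed[OF counit_ring_hom] ring_hom_add[OF counit_ring_hom]
  ring_hom_mult[OF counit_ring_hom] ring_hom_one[OF counit_ring_hom]

lemma HH_module_sel [simp]:
  "carrier (HH_module K) = carrier HH"
  "add (HH_module K) = add HH"
  "\<zero>\<^bsub>HH_module K\<^esub> = \<zero>\<^bsub>HH\<^esub>"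
  "h \<odot>\<^bsub>HH_module K\<^esub> x = x \<otimes>\<^bsub>HH\<^esub> H_coproduct K h"
  by (simp_all add: HH_module_def Let_def ring.defs module.defs)

text \<open>
  The right action of \<open>h\<close> is multiplication by \<open>\<Delta>(h)\<close>, so the module laws express that \<open>\<Delta>\<close> is a
  ring homomorphism.
\<close>

lemma HH_module_module: "module (UP K) (HH_module K)"
proof (rule moduleI)
  show "abelian_group (HH_module K)"
    by (rule abelian_group_cong[OF HH.tensor_abelian_group]) simp_all
qed (simp_all add: U.is_cring HH.l_distr HH.r_distr HH.m_ac)

end

section \<open>Pseudotensors and their expansions\<close>

lemma (in abelian_monoid) finsum_lessThan_Suc:
  assumes "\<And>i. i \<le> n \<Longrightarrow> t i \<in> carrier G"
  shows "(\<Oplus>i\<in>{..<n}. t i) \<in> carrier G"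
    and "(\<Oplus>i\<in>{..<Suc n}. t i) = (\<Oplus>i\<in>{..<n}. t i) \<oplus> t n"
proof -
  show 1: "(\<Oplus>i\<in>{..<n}. t i) \<in> carrier G"
    using assms by (intro finsum_closed) auto
  have "(\<Oplus>i\<in>{..<Suc n}. t i) = t n \<oplus> (\<Oplus>i\<in>{..<n}. t i)"
    unfolding lessThan_Suc using assms by (intro finsum_insert) auto
  then show "(\<Oplus>i\<in>{..<Suc n}. t i) = (\<Oplus>i\<in>{..<n}. t i) \<oplus> t n"
    using 1 assms by (simp add: a_comm)
qed

text \<open>
  \<open>C\<close> is the \<open>H\<close>-module underlying a conformal algebra; \<open>PT\<close> is \<open>(H \<otimes> H) \<otimes>\<^sub>H C\<close>, where
  pseudo-products take their values.
\<close>

locale pseudotensor_module = polynomial_hopf_algebra K + C: module "UP K" C for K (structure) and C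
begin

sublocale P: module_pair "UP K" "HH_module K" C
  by (intro module_pair.intro HH_module_module C.module_axioms)

abbreviation PT where "PT \<equiv> tensor (UP K) (HH_module K) C"

lemma ptensor_closed [simp]:
  "\<lbrakk>f \<in> carrier (UP K); g \<in> carrier (UP K); c \<in> carrier C\<rbrakk> \<Longrightarrow> ptensor K C f g c \<in> carrier PT"
  by (simp add: ptensor_def)

lemma ptensor_add:
  shows "\<lbrakk>f \<in> carrier (UP K); f' \<in> carrier (UP K); g \<in> carrier (UP K); c \<in> carrier C\<rbrakk>
      \<Longrightarrow> ptensor K C (f \<oplus>\<^bsub>UP K\<^esub> f') g c = ptensor K C f g c \<oplus>\<^bsub>PT\<^esub> ptensor K C f' g c"
    and "\<lbrakk>f \<in> carrier (UP K); g \<in> carrier (UP K); g' \<in> carrier (UP K); c \<in> carrier C\<rbrakk>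
      \<Longrightarrow> ptensor K C f (g \<oplus>\<^bsub>UP K\<^esub> g') c = ptensor K C f g c \<oplus>\<^bsub>PT\<^esub> ptensor K C f g' c"
    and "\<lbrakk>f \<in> carrier (UP K); g \<in> carrier (UP K); c \<in> carrier C; c' \<in> carrier C\<rbrakk>
      \<Longrightarrow> ptensor K C f g (c \<oplus>\<^bsub>C\<^esub> c') = ptensor K C f g c \<oplus>\<^bsub>PT\<^esub> ptensor K C f g c'"
  using P.pure_tensor_add_left[of "HH_pure K f g" "HH_pure K f' g" c]
    P.pure_tensor_add_left[of "HH_pure K f g" "HH_pure K f g'" c]
  by (simp_all add: ptensor_def HH.pure_tensor_add_left HH.pure_tensor_add_right P.pure_tensor_add_right)

lemma pure_coproduct:
  "\<lbrakk>x \<in> carrier HH; h \<in> carrier (UP K); c \<in> carrier C\<rbrakk>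
    \<Longrightarrow> pure_tensor (UP K) (HH_module K) C (x \<otimes>\<^bsub>HH\<^esub> H_coproduct K h) c
      = pure_tensor (UP K) (HH_module K) C x (h \<odot>\<^bsub>C\<^esub> c)"
  using P.pure_tensor_balanced[of h x c] by simp

lemma ptensor_smult_const:
  assumes "a \<in> carrier K" "f \<in> carrier (UP K)" "g \<in> carrier (UP K)" "c \<in> carrier C"
  shows "ptensor K C f g (const a \<odot>\<^bsub>C\<^esub> c) = ptensor K C (a \<odot>\<^bsub>UP K\<^esub> f) g c"
  using pure_coproduct[of "HH_pure K f g" "const a" c] assms
  by (simp add: ptensor_def coproduct_const smult_eq_const_mult U.m_comm)

lemma ptensor_smult_right:
  assumes "a \<in> carrier K" "f \<in> carrier (UP K)" "g \<in> carrier (UP K)" "c \<in> carrier C"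
  shows "ptensor K C f (a \<odot>\<^bsub>UP K\<^esub> g) c = ptensor K C (a \<odot>\<^bsub>UP K\<^esub> f) g c"
  using assms HH.pure_tensor_balanced[of a f g] by (simp add: ptensor_def)

lemma ptensor_zero:
  "\<lbrakk>g \<in> carrier (UP K); c \<in> carrier C\<rbrakk> \<Longrightarrow> ptensor K C \<zero>\<^bsub>UP K\<^esub> g c = \<zero>\<^bsub>PT\<^esub>"
  using P.pure_tensor_zero_left[of c] by (simp add: ptensor_def HH.pure_tensor_zero_left)

lemma ptensor_minus:
  assumes "f \<in> carrier (UP K)" "g \<in> carrier (UP K)" "c \<in> carrier C"
  shows "ptensor K C (\<ominus>\<^bsub>UP K\<^esub> f) g c = \<ominus>\<^bsub>PT\<^esub> ptensor K C f g c"
proof -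
  have "ptensor K C (\<ominus>\<^bsub>UP K\<^esub> f) g c \<oplus>\<^bsub>PT\<^esub> ptensor K C f g c = \<zero>\<^bsub>PT\<^esub>"
    using ptensor_add(1)[of "\<ominus>\<^bsub>UP K\<^esub> f" f g c] assms by (simp add: U.l_neg ptensor_zero)
  then show ?thesis
    using assms by (simp add: P.T.minus_equality)
qed

text \<open>
  Multiplying \<open>f \<otimes> g\<close> by \<open>\<Delta>(T)\<close> gives \<open>f T \<otimes> g + f \<otimes> g T\<close>, and \<open>\<Delta>(T)\<close> can be moved across the
  tensor sign onto \<open>c\<close>. Thus a factor \<open>T\<close> in the second place is traded for one in the first place
  and one acting on \<open>c\<close>.
\<close>

lemma ptensor_T:
  assumes "f \<in> carrier (UP K)" "g \<in> carrier (UP K)" "c \<in> carrier C"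
  shows "ptensor K C f (g \<otimes>\<^bsub>UP K\<^esub> T) c
    = ptensor K C f g (T \<odot>\<^bsub>C\<^esub> c) \<oplus>\<^bsub>PT\<^esub> ptensor K C (\<ominus>\<^bsub>UP K\<^esub> (f \<otimes>\<^bsub>UP K\<^esub> T)) g c"
proof -
  have T: "T \<in> carrier (UP K)"
    by simp
  have "HH_pure K f g \<otimes>\<^bsub>HH\<^esub> H_coproduct K T
      = HH_pure K (f \<otimes>\<^bsub>UP K\<^esub> T) g \<oplus>\<^bsub>HH\<^esub> HH_pure K f (g \<otimes>\<^bsub>UP K\<^esub> T)"
    unfolding coproduct_T using assms T by (simp add: HH.tensor_mult_add_right)
  then have "ptensor K C f g (T \<odot>\<^bsub>C\<^esub> c)
      = ptensor K C (f \<otimes>\<^bsub>UP K\<^esub> T) g c \<oplus>\<^bsub>PT\<^esub> ptensor K C f (g \<otimes>\<^bsub>UP K\<^esub> T) c"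
    using pure_coproduct[of "HH_pure K f g" T c] assms T
      P.pure_tensor_add_left[of "HH_pure K (f \<otimes>\<^bsub>UP K\<^esub> T) g" "HH_pure K f (g \<otimes>\<^bsub>UP K\<^esub> T)" c]
    by (simp add: ptensor_def)
  moreover have "ptensor K C (\<ominus>\<^bsub>UP K\<^esub> (f \<otimes>\<^bsub>UP K\<^esub> T)) g c = \<ominus>\<^bsub>PT\<^esub> ptensor K C (f \<otimes>\<^bsub>UP K\<^esub> T) g c"
    using assms T by (simp add: ptensor_minus)
  ultimately show ?thesis
    using assms T by (simp add: P.T.a_ac P.T.r_neg P.T.r_neg1 P.T.r_neg2)
qed

text \<open>
  The elements of \<open>(H \<otimes> H) \<otimes>\<^sub>H C\<close> from which the dialgebra operations can be read off.
\<close>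

definition expandable where
  "expandable Y \<longleftrightarrow> (\<exists>n h c. h \<in> {..<n::nat} \<rightarrow> carrier (UP K) \<and> c \<in> {..<n} \<rightarrow> carrier C \<and>
     Y = (\<Oplus>\<^bsub>PT\<^esub>i\<in>{..<n}. ptensor K C (h i) \<one>\<^bsub>UP K\<^esub> (c i)))"

lemma expandable_step:
  assumes "expandable Y" "f \<in> carrier (UP K)" "d \<in> carrier C"
  shows "expandable (Y \<oplus>\<^bsub>PT\<^esub> ptensor K C f \<one>\<^bsub>UP K\<^esub> d)"
proof -
  obtain n h c where Y: "h \<in> {..<n::nat} \<rightarrow> carrier (UP K)" "c \<in> {..<n} \<rightarrow> carrier C"
    "Y = (\<Oplus>\<^bsub>PT\<^esub>i\<in>{..<n}. ptensor K C (h i) \<one>\<^bsub>UP K\<^esub> (c i))"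
    using assms(1) unfolding expandable_def by blast
  define t where "t = (\<lambda>i. ptensor K C ((h(n := f)) i) \<one>\<^bsub>UP K\<^esub> ((c(n := d)) i))"
  have t: "t i \<in> carrier PT" if "i \<le> n" for i
    using that Y(1,2) assms(2,3) by (cases "i = n") (auto simp: t_def intro!: ptensor_closed)
  have "(\<Oplus>\<^bsub>PT\<^esub>i\<in>{..<n}. t i) = Y"
    unfolding Y(3) by (rule P.T.finsum_cong') (use Y(1,2) in \<open>auto simp: t_def intro!: ptensor_closed\<close>)
  moreover have "t n = ptensor K C f \<one>\<^bsub>UP K\<^esub> d"
    by (simp add: t_def)
  ultimately have "Y \<oplus>\<^bsub>PT\<^esub> ptensor K C f \<one>\<^bsub>UP K\<^esub> d = (\<Oplus>\<^bsub>PT\<^esub>i\<in>{..<Suc n}. t i)"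
    using P.T.finsum_lessThan_Suc(2)[of n t, OF t] by simp
  moreover have "h(n := f) \<in> {..<Suc n} \<rightarrow> carrier (UP K)" "c(n := d) \<in> {..<Suc n} \<rightarrow> carrier C"
    using Y(1,2) assms(2,3) by (auto simp: Pi_iff less_Suc_eq)
  ultimately show ?thesis
    unfolding expandable_def t_def by blast
qed

lemma expandable_zero: "expandable \<zero>\<^bsub>PT\<^esub>"
  unfolding expandable_def by (rule exI[of _ 0]) auto

lemma expandable_closed: "expandable Y \<Longrightarrow> Y \<in> carrier PT"
  unfolding expandable_def by (auto intro!: P.T.finsum_closed ptensor_closed)

lemma expandable_add:
  assumes "expandable Y" "expandable Z"
  shows "expandable (Y \<oplus>\<^bsub>PT\<^esub> Z)"
proof -
  obtain n h c where Z: "h \<in> {..<n::nat} \<rightarrow> carrier (UP K)" "c \<in> {..<n} \<rightarrow> carrier C"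
    "Z = (\<Oplus>\<^bsub>PT\<^esub>i\<in>{..<n}. ptensor K C (h i) \<one>\<^bsub>UP K\<^esub> (c i))"
    using assms(2) unfolding expandable_def by blast
  note Yc = expandable_closed[OF assms(1)]
  have t: "ptensor K C (h i) \<one>\<^bsub>UP K\<^esub> (c i) \<in> carrier PT" if "i < n" for i
    using that Z(1,2) by (auto intro!: ptensor_closed)
  have "expandable (Y \<oplus>\<^bsub>PT\<^esub> (\<Oplus>\<^bsub>PT\<^esub>i\<in>{..<m}. ptensor K C (h i) \<one>\<^bsub>UP K\<^esub> (c i)))" if "m \<le> n" for m
    using that
  proof (induction m)
    case 0
    then show ?case
      using assms(1) Yc by simp
  next
    case (Suc m)
    have tm: "ptensor K C (h i) \<one>\<^bsub>UP K\<^esub> (c i) \<in> carrier PT" if "i \<le> m" for i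
      using t that Suc.prems by simp
    note sum = P.T.finsum_lessThan_Suc[of m "\<lambda>i. ptensor K C (h i) \<one>\<^bsub>UP K\<^esub> (c i)"]
    have hc: "h m \<in> carrier (UP K)" "c m \<in> carrier C"
      using Z(1,2) Suc.prems by auto
    have "expandable (Y \<oplus>\<^bsub>PT\<^esub> (\<Oplus>\<^bsub>PT\<^esub>i\<in>{..<m}. ptensor K C (h i) \<one>\<^bsub>UP K\<^esub> (c i))
        \<oplus>\<^bsub>PT\<^esub> ptensor K C (h m) \<one>\<^bsub>UP K\<^esub> (c m))"
      using expandable_step[OF Suc.IH hc] Suc.prems by simp
    then show ?case
      using P.T.a_assoc[OF Yc sum(1) tm[of m]] tm by (simp add: sum(2))
  qed
  then show ?thesis
    unfolding Z(3) by simp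
qed

text \<open>
  By induction on \<open>g\<close>: the constants move to the first place, and each factor \<open>T\<close> is removed by
  the previous exchange. Solving the recursion gives \<open>f \<otimes> g = (f S(g\<^sub>(\<^sub>1\<^sub>)) \<otimes> 1) g\<^sub>(\<^sub>2\<^sub>)\<close>.
\<close>

lemma expandable_ptensor:
  assumes "f \<in> carrier (UP K)" "g \<in> carrier (UP K)" "c \<in> carrier C"
  shows "expandable (ptensor K C f g c)"
  using assms(2,1,3)
proof (induction arbitrary: f c rule: UP_induct)
  case (const a)
  have "ptensor K C f (const a) c = ptensor K C (a \<odot>\<^bsub>UP K\<^esub> f) \<one>\<^bsub>UP K\<^esub> c"
    using ptensor_smult_right[of a f "\<one>\<^bsub>UP K\<^esub>" c] const by (simp add: smult_eq_const_mult)
  then show ?case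
    using expandable_step[OF expandable_zero, of "a \<odot>\<^bsub>UP K\<^esub> f" c] const by simp
next
  case (T g)
  then show ?case
    by (simp add: ptensor_T expandable_add)
next
  case (add g g')
  then show ?case
    by (simp add: ptensor_add expandable_add)
qed

lemma expandable_all:
  assumes "Y \<in> carrier PT"
  shows "expandable Y"
  using assms
proof (induction rule: P.tensor_induct)
  case (pure x c)
  from pure(1) have "x \<in> carrier HH"
    by simp
  then show ?case
    using pure(2)
  proof (induction rule: HH.tensor_induct)
    case (pure f g)
    then show ?case
      using expandable_ptensor by (simp add: ptensor_def)
  next
    case (add x y)
    then show ?case
      using P.pure_tensor_add_left[of x y c] by (simp add: expandable_add)
  qed
qed (rule expandable_add)

end

text \<open>
  For \<open>K\<close>-algebra endomorphisms \<open>u\<close> and \<open>v\<close> of \<open>K[T]\<close> with \<open>u(T) + v(T) = T\<close>, the homomorphism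
  \<open>f \<otimes> g \<mapsto> u(f) v(g)\<close> is a left inverse of \<open>\<Delta>\<close>, since both sides of \<open>u(h\<^sub>(\<^sub>1\<^sub>)) v(h\<^sub>(\<^sub>2\<^sub>)) = h\<close> are
  ring homomorphisms in \<open>h\<close> that agree on the constants and at \<open>T\<close>. The case \<open>u = \<epsilon>\<close>, \<open>v = id\<close> describes \<open>\<turnstile>\<close>,
  and the case \<open>u = id\<close>, \<open>v = \<epsilon>\<close> describes \<open>\<stileturn>\<close>.
\<close>

locale coproduct_splitting = polynomial_hopf_algebra +
  fixes u v
  assumes u_hom: "u \<in> ring_hom (UP K) (UP K)"
    and v_hom: "v \<in> ring_hom (UP K) (UP K)"
    and u_const: "\<And>c. c \<in> carrier K \<Longrightarrow> u (const c) = const c"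
    and v_const: "\<And>c. c \<in> carrier K \<Longrightarrow> v (const c) = const c"
    and uv_T: "u T \<oplus>\<^bsub>UP K\<^esub> v T = T"
begin

lemmas uv_hom =
  ring_hom_closed[OF u_hom] ring_hom_add[OF u_hom] ring_hom_mult[OF u_hom] ring_hom_one[OF u_hom]
  ring_hom_closed[OF v_hom] ring_hom_add[OF v_hom] ring_hom_mult[OF v_hom] ring_hom_one[OF v_hom]

definition fold_HH where
  "fold_HH = tensor_lift (add_monoid (UP K)) (\<lambda>f g. u f \<otimes>\<^bsub>UP K\<^esub> v g)"

lemma fold_HH_balanced_map:
  "balanced_map K (UP K) (UP K) (UP K) (add_monoid (UP K)) (\<lambda>f g. u f \<otimes>\<^bsub>UP K\<^esub> v g)"
  by unfold_locales
    (simp_all add: uv_hom U.l_distr U.r_distr smult_eq_const_mult u_const v_const U.m_ac)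

lemmas fold_HH_closed [simp] =
  balanced_map.tensor_lift_closed[OF fold_HH_balanced_map, folded fold_HH_def]
lemmas fold_HH_add [simp] =
  balanced_map.tensor_lift_add[OF fold_HH_balanced_map, folded fold_HH_def]
lemmas fold_HH_pure [simp] =
  balanced_map.tensor_lift_pure[OF fold_HH_balanced_map, folded fold_HH_def]

lemma fold_HH_mult:
  assumes "x \<in> carrier HH" "y \<in> carrier HH"
  shows "fold_HH (x \<otimes>\<^bsub>HH\<^esub> y) = fold_HH x \<otimes>\<^bsub>UP K\<^esub> fold_HH y"
  using assms(1)
proof (induction rule: HH.tensor_induct)
  case (pure f g)
  show ?case
    using assms(2) pure
  proof (induction rule: HH.tensor_induct)
    case (pure f' g')
    then show ?case
      by (simp add: uv_hom U.m_ac)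
  next
    case (add x y)
    then show ?case
      by (simp add: uv_hom HH.tensor_mult_add_right U.r_distr)
  qed
next
  case (add x x')
  then show ?case
    using assms(2) by (simp add: HH.tensor_mult_add_left U.l_distr)
qed

lemma fold_HH_coproduct:
  assumes "h \<in> carrier (UP K)"
  shows "fold_HH (H_coproduct K h) = h"
  using assms
proof (induction rule: UP_induct)
  case (const c)
  then show ?case
    by (simp add: uv_hom coproduct_const u_const)
next
  case (T f)
  have "fold_HH (H_coproduct K T) = T"
    unfolding coproduct_T by (simp add: uv_hom uv_T)
  with T show ?case
    by (simp add: fold_HH_mult)
next
  case (add f f')
  then show ?case
    by simp
qed

end

locale pseudotensor_splitting = pseudotensor_module + coproduct_splitting
begin

text \<open>
  The map \<open>(f \<otimes> g) \<otimes>\<^sub>H c \<mapsto> u(f) v(g) c\<close>. It is balanced over \<open>H\<close> because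
  \<open>f \<otimes> g \<mapsto> u(f) v(g)\<close> splits the coproduct.
\<close>

definition fold_PT where
  "fold_PT = tensor_lift (add_monoid C) (\<lambda>x c. fold_HH x \<odot>\<^bsub>C\<^esub> c)"

lemma fold_PT_balanced_map:
  "balanced_map (UP K) (HH_module K) C C (add_monoid C) (\<lambda>x c. fold_HH x \<odot>\<^bsub>C\<^esub> c)"
  by unfold_locales
    (simp_all add: C.smult_l_distr C.smult_r_distr fold_HH_mult fold_HH_coproduct C.smult_assoc1)

lemmas fold_PT_closed [simp] =
  balanced_map.tensor_lift_closed[OF fold_PT_balanced_map, folded fold_PT_def]
lemmas fold_PT_add [simp] =
  balanced_map.tensor_lift_add[OF fold_PT_balanced_map, folded fold_PT_def]

lemma fold_PT_ptensor [simp]: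
  "\<lbrakk>f \<in> carrier (UP K); g \<in> carrier (UP K); c \<in> carrier C\<rbrakk>
    \<Longrightarrow> fold_PT (ptensor K C f g c) = (u f \<otimes>\<^bsub>UP K\<^esub> v g) \<odot>\<^bsub>C\<^esub> c"
  using balanced_map.tensor_lift_pure[OF fold_PT_balanced_map, folded fold_PT_def, of "HH_pure K f g" c]
  by (simp add: uv_hom ptensor_def)

text \<open>
  The sum on the right depends only on the pseudotensor and not on the expansion, as it is the value
  of a well-defined map. This is the uniqueness behind the dialgebra operations.
\<close>

lemma fold_PT_expansion:
  assumes "h \<in> {..<n::nat} \<rightarrow> carrier (UP K)" "c \<in> {..<n} \<rightarrow> carrier C"
  shows "fold_PT (\<Oplus>\<^bsub>PT\<^esub>i\<in>{..<n}. ptensor K C (h i) \<one>\<^bsub>UP K\<^esub> (c i)) = (\<Oplus>\<^bsub>C\<^esub>i\<in>{..<n}. u (h i) \<odot>\<^bsub>C\<^esub> c i)"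
  using assms
proof (induction n)
  case 0
  have "fold_PT \<zero>\<^bsub>PT\<^esub> \<oplus>\<^bsub>C\<^esub> fold_PT \<zero>\<^bsub>PT\<^esub> = fold_PT \<zero>\<^bsub>PT\<^esub>"
    using fold_PT_add[of "\<zero>\<^bsub>PT\<^esub>" "\<zero>\<^bsub>PT\<^esub>"] by simp
  then show ?case
    using fold_PT_closed[of "\<zero>\<^bsub>PT\<^esub>"] by simp
next
  case (Suc n)
  have hc: "h i \<in> carrier (UP K)" "c i \<in> carrier C" if "i \<le> n" for i
    using Suc.prems that by auto
  note P_sum = P.T.finsum_lessThan_Suc[of n "\<lambda>i. ptensor K C (h i) \<one>\<^bsub>UP K\<^esub> (c i)"]
  note C_sum = C.finsum_lessThan_Suc(2)[of n "\<lambda>i. u (h i) \<odot>\<^bsub>C\<^esub> c i"]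
  have "fold_PT (\<Oplus>\<^bsub>PT\<^esub>i\<in>{..<n}. ptensor K C (h i) \<one>\<^bsub>UP K\<^esub> (c i)) = (\<Oplus>\<^bsub>C\<^esub>i\<in>{..<n}. u (h i) \<odot>\<^bsub>C\<^esub> c i)"
    using Suc.prems by (intro Suc.IH) auto
  then show ?case
    using hc P_sum(1) by (simp add: uv_hom P_sum(2) C_sum)
qed

end

section \<open>The dialgebra of a conformal algebra\<close>

text \<open>
  The counit laws of the Hopf algebra, \<open>\<epsilon>(h\<^sub>(\<^sub>1\<^sub>)) h\<^sub>(\<^sub>2\<^sub>) = h = h\<^sub>(\<^sub>1\<^sub>) \<epsilon>(h\<^sub>(\<^sub>2\<^sub>))\<close>.
\<close>

lemma (in polynomial_hopf_algebra) counit_splittings: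
  shows "coproduct_splitting K (\<lambda>f. const (H_counit K f)) (\<lambda>f. f)"
    and "coproduct_splitting K (\<lambda>f. f) (\<lambda>f. const (H_counit K f))"
proof -
  have "(\<lambda>f. const (H_counit K f)) \<in> ring_hom (UP K) (UP K)"
  proof (rule ring_hom_memI)
    fix f g
    assume "f \<in> carrier (UP K)" "g \<in> carrier (UP K)"
    then show "const (H_counit K (f \<otimes>\<^bsub>UP K\<^esub> g)) = const (H_counit K f) \<otimes>\<^bsub>UP K\<^esub> const (H_counit K g)"
      using U.monom_mult[of "H_counit K f" "H_counit K g" 0 0] by simp
  qed simp_all
  moreover have "(\<lambda>f. f) \<in> ring_hom (UP K) (UP K)"
    by (simp add: ring_hom_def)
  ultimately show "coproduct_splitting K (\<lambda>f. const (H_counit K f)) (\<lambda>f. f)"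
    "coproduct_splitting K (\<lambda>f. f) (\<lambda>f. const (H_counit K f))"
    by (unfold_locales; simp)+
qed

locale conformal = pseudotensor_module K C
  for K :: "('k, 'm) ring_scheme" (structure) and C :: "('k, 'c, 'n) conformal_algebra_scheme" +
  assumes pprod_closed [simp]: "\<lbrakk>x \<in> carrier C; y \<in> carrier C\<rbrakk> \<Longrightarrow> pprod C x y \<in> carrier PT"
begin

sublocale left: pseudotensor_splitting K C "\<lambda>f. const (H_counit K f)" "\<lambda>f. f"
  by (intro pseudotensor_splitting.intro pseudotensor_module_axioms counit_splittings)

sublocale right: pseudotensor_splitting K C "\<lambda>f. f" "\<lambda>f. const (H_counit K f)"
  by (intro pseudotensor_splitting.intro pseudotensor_module_axioms counit_splittings)

lemma conformal_dialgebra_sel [simp]: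
  "carrier (conformal_dialgebra K C) = carrier C"
  "add (conformal_dialgebra K C) = add C"
  "\<zero>\<^bsub>conformal_dialgebra K C\<^esub> = \<zero>\<^bsub>C\<^esub>"
  "smult (conformal_dialgebra K C) = const_smult K C"
  by (simp_all add: conformal_dialgebra_def ring.defs module.defs dialgebra.defs)

lemma ex_expansion:
  assumes "x \<in> carrier C" "y \<in> carrier C"
  shows "\<exists>n h c. pprod_expansion K C x y n h c"
  using expandable_all[OF pprod_closed[OF assms]]
  unfolding expandable_def pprod_expansion_def .

text \<open>
  An expansion of the pseudo-product exists, and every expansion gives the same value, namely that
  of the folding map with \<open>u = \<epsilon>\<close>. Hence the definite description denotes this value.
\<close>

lemma vdash_eq:
  assumes "x \<in> carrier C" "y \<in> carrier C"
  shows "vdash (conformal_dialgebra K C) x y = left.fold_PT (pprod C x y)"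
proof -
  have sum: "(\<Oplus>\<^bsub>C\<^esub>i\<in>{..<n}. const_smult K C (H_counit K (h i)) (c i)) = left.fold_PT (pprod C x y)"
    if "pprod_expansion K C x y n h c" for n h c
    using that unfolding pprod_expansion_def const_smult_def by (elim conjE) (simp only: left.fold_PT_expansion)
  have "vdash (conformal_dialgebra K C) x y = (THE d. \<exists>n h c. pprod_expansion K C x y n h c \<and>
      d = (\<Oplus>\<^bsub>C\<^esub>i\<in>{..<n}. const_smult K C (H_counit K (h i)) (c i)))"
    by (simp add: conformal_dialgebra_def ring.defs module.defs dialgebra.defs)
  also have "\<dots> = left.fold_PT (pprod C x y)"
  proof (rule the_equality)
    obtain n h c where "pprod_expansion K C x y n h c"
      using ex_expansion[OF assms] by blast
    with sum[OF this] show "\<exists>n h c. pprod_expansion K C x y n h c \<and> left.fold_PT (pprod C x y)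
        = (\<Oplus>\<^bsub>C\<^esub>i\<in>{..<n}. const_smult K C (H_counit K (h i)) (c i))"
      by metis
  qed (use sum in blast)
  finally show ?thesis .
qed

lemma dashv_eq:
  assumes "x \<in> carrier C" "y \<in> carrier C"
  shows "dashv (conformal_dialgebra K C) x y = right.fold_PT (pprod C x y)"
proof -
  have sum: "(\<Oplus>\<^bsub>C\<^esub>i\<in>{..<n}. h i \<odot>\<^bsub>C\<^esub> c i) = right.fold_PT (pprod C x y)"
    if "pprod_expansion K C x y n h c" for n h c
    using that unfolding pprod_expansion_def by (elim conjE) (simp only: right.fold_PT_expansion)
  have "dashv (conformal_dialgebra K C) x y = (THE d. \<exists>n h c. pprod_expansion K C x y n h c \<and>
      d = (\<Oplus>\<^bsub>C\<^esub>i\<in>{..<n}. h i \<odot>\<^bsub>C\<^esub> c i))"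
    by (simp add: conformal_dialgebra_def ring.defs module.defs dialgebra.defs)
  also have "\<dots> = right.fold_PT (pprod C x y)"
  proof (rule the_equality)
    obtain n h c where "pprod_expansion K C x y n h c"
      using ex_expansion[OF assms] by blast
    with sum[OF this] show "\<exists>n h c. pprod_expansion K C x y n h c \<and> right.fold_PT (pprod C x y)
        = (\<Oplus>\<^bsub>C\<^esub>i\<in>{..<n}. h i \<odot>\<^bsub>C\<^esub> c i)"
      by metis
  qed (use sum in blast)
  finally show ?thesis .
qed

end


section \<open>Current conformal algebras\<close>

locale current_module = polynomial_hopf_algebra K + A: module K A for K (structure) and A
begin

sublocale HA: module_pair K "UP K" A
  by (intro module_pair.intro algebra.axioms(1)[OF U.UP_algebra] A.module_axioms)

abbreviation HA where "HA \<equiv> tensor K (UP K) A"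

lemma Cur_module_sel [simp]:
  "carrier (Cur_module K A) = carrier HA"
  "add (Cur_module K A) = add HA"
  "\<zero>\<^bsub>Cur_module K A\<^esub> = \<zero>\<^bsub>HA\<^esub>"
  by (simp_all add: Cur_module_def ring.defs module.defs)

lemma Cur_smult_eq:
  "h \<odot>\<^bsub>Cur_module K A\<^esub> x = tensor_lift (tensor_group K (UP K) A)
     (\<lambda>f a. pure_tensor K (UP K) A (h \<otimes>\<^bsub>UP K\<^esub> f) a) x"
  by (simp add: Cur_module_def ring.defs module.defs)

lemma Cur_smult_balanced_map:
  assumes h: "h \<in> carrier (UP K)"
  shows "balanced_map K (UP K) A HA (tensor_group K (UP K) A)
    (\<lambda>f a. pure_tensor K (UP K) A (h \<otimes>\<^bsub>UP K\<^esub> f) a)"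
proof unfold_locales
  fix k f a
  assume "k \<in> carrier K" "f \<in> carrier (UP K)" "a \<in> carrier A"
  then show "pure_tensor K (UP K) A (h \<otimes>\<^bsub>UP K\<^esub> (k \<odot>\<^bsub>UP K\<^esub> f)) a
      = pure_tensor K (UP K) A (h \<otimes>\<^bsub>UP K\<^esub> f) (k \<odot>\<^bsub>A\<^esub> a)"
    using h HA.pure_tensor_balanced[of k "h \<otimes>\<^bsub>UP K\<^esub> f" a] by (simp add: smult_eq_const_mult U.m_ac)
qed (use h in \<open>simp_all add: U.r_distr HA.pure_tensor_add_left HA.pure_tensor_add_right\<close>)

lemmas Cur_smult_closed [simp] =
  balanced_map.tensor_lift_closed[OF Cur_smult_balanced_map, folded Cur_smult_eq]
lemmas Cur_smult_add =
  balanced_map.tensor_lift_add[OF Cur_smult_balanced_map, folded Cur_smult_eq]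
lemmas Cur_smult_pure [simp] =
  balanced_map.tensor_lift_pure[OF Cur_smult_balanced_map, folded Cur_smult_eq]

lemma Cur_module_module: "module (UP K) (Cur_module K A)"
proof (rule moduleI)
  show "abelian_group (Cur_module K A)"
    by (rule abelian_group_cong[OF HA.tensor_abelian_group]) simp_all
next
  fix g h x
  assume gh: "g \<in> carrier (UP K)" "h \<in> carrier (UP K)" and x: "x \<in> carrier (Cur_module K A)"
  from x have x': "x \<in> carrier HA"
    by simp
  show "(g \<oplus>\<^bsub>UP K\<^esub> h) \<odot>\<^bsub>Cur_module K A\<^esub> x
      = g \<odot>\<^bsub>Cur_module K A\<^esub> x \<oplus>\<^bsub>Cur_module K A\<^esub> h \<odot>\<^bsub>Cur_module K A\<^esub> x"
    using x'
  proof (induction rule: HA.tensor_induct)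
    case (pure f a)
    then show ?case
      using gh by (simp add: U.l_distr HA.pure_tensor_add_left)
  next
    case (add x y)
    then show ?case
      using gh by (simp add: Cur_smult_add HA.T.a_ac)
  qed
  show "(g \<otimes>\<^bsub>UP K\<^esub> h) \<odot>\<^bsub>Cur_module K A\<^esub> x = g \<odot>\<^bsub>Cur_module K A\<^esub> (h \<odot>\<^bsub>Cur_module K A\<^esub> x)"
    using x'
  proof (induction rule: HA.tensor_induct)
    case (pure f a)
    then show ?case
      using gh by (simp add: U.m_assoc)
  next
    case (add x y)
    then show ?case
      using gh by (simp add: Cur_smult_add)
  qed
next
  fix x
  assume "x \<in> carrier (Cur_module K A)"
  then have "x \<in> carrier HA"
    by simp
  then show "\<one>\<^bsub>UP K\<^esub> \<odot>\<^bsub>Cur_module K A\<^esub> x = x"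
  proof (induction rule: HA.tensor_induct)
    case (pure f a)
    then show ?case
      by simp
  next
    case (add x y)
    then show ?case
      by (simp add: Cur_smult_add)
  qed
qed (simp_all add: U.is_cring Cur_smult_add)

end

locale current_algebra = current_module +
  assumes A_mult_closed [simp]: "\<lbrakk>a \<in> carrier A; b \<in> carrier A\<rbrakk> \<Longrightarrow> a \<otimes>\<^bsub>A\<^esub> b \<in> carrier A"
    and A_mult_add_left: "\<lbrakk>a \<in> carrier A; a' \<in> carrier A; b \<in> carrier A\<rbrakk>
      \<Longrightarrow> (a \<oplus>\<^bsub>A\<^esub> a') \<otimes>\<^bsub>A\<^esub> b = a \<otimes>\<^bsub>A\<^esub> b \<oplus>\<^bsub>A\<^esub> a' \<otimes>\<^bsub>A\<^esub> b"
    and A_mult_add_right: "\<lbrakk>a \<in> carrier A; b \<in> carrier A; b' \<in> carrier A\<rbrakk>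
      \<Longrightarrow> a \<otimes>\<^bsub>A\<^esub> (b \<oplus>\<^bsub>A\<^esub> b') = a \<otimes>\<^bsub>A\<^esub> b \<oplus>\<^bsub>A\<^esub> a \<otimes>\<^bsub>A\<^esub> b'"
    and A_mult_smult_left: "\<lbrakk>k \<in> carrier K; a \<in> carrier A; b \<in> carrier A\<rbrakk>
      \<Longrightarrow> (k \<odot>\<^bsub>A\<^esub> a) \<otimes>\<^bsub>A\<^esub> b = k \<odot>\<^bsub>A\<^esub> (a \<otimes>\<^bsub>A\<^esub> b)"
    and A_mult_smult_right: "\<lbrakk>k \<in> carrier K; a \<in> carrier A; b \<in> carrier A\<rbrakk>
      \<Longrightarrow> a \<otimes>\<^bsub>A\<^esub> (k \<odot>\<^bsub>A\<^esub> b) = k \<odot>\<^bsub>A\<^esub> (a \<otimes>\<^bsub>A\<^esub> b)"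
begin

lemma Cur_sel [simp]:
  "carrier (Cur K A) = carrier HA"
  "add (Cur K A) = add HA"
  "\<zero>\<^bsub>Cur K A\<^esub> = \<zero>\<^bsub>HA\<^esub>"
  "smult (Cur K A) = smult (Cur_module K A)"
  by (simp_all add: Cur_def Let_def module.defs conformal_algebra.defs)

lemma Cur_is_module: "module (UP K) (Cur K A)"
proof -
  interpret C: module "UP K" "Cur_module K A"
    by (rule Cur_module_module)
  have "abelian_group (Cur K A)"
    by (rule abelian_group_cong[OF HA.tensor_abelian_group]) simp_all
  then show ?thesis
    using C.smult_l_distr C.smult_r_distr C.smult_assoc1
    by (intro moduleI) (simp_all add: U.is_cring)
qed

sublocale Cur: pseudotensor_module K "Cur K A"
  by (intro pseudotensor_module.intro polynomial_hopf_algebra_axioms Cur_is_module)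

text \<open>
  The pseudo-product is defined with tensor products over the bare module \<open>Cur_module K A\<close>; they
  coincide with those over the conformal algebra, which has the same module structure.
\<close>

lemma Cur_pure_tensor:
  "pure_tensor (UP K) (HH_module K) (Cur_module K A) = pure_tensor (UP K) (HH_module K) (Cur K A)"
  "tensor_group (UP K) (HH_module K) (Cur_module K A) = tensor_group (UP K) (HH_module K) (Cur K A)"
  by (simp_all add: fun_eq_iff pure_tensor_def tensor_group_def tensor_null_def tensor_relators_def)

lemma Cur_pprod_eq:
  "pprod (Cur K A) x y = tensor_lift (tensor_group (UP K) (HH_module K) (Cur K A))
     (\<lambda>f a. tensor_lift (tensor_group (UP K) (HH_module K) (Cur K A))
        (\<lambda>h b. ptensor K (Cur K A) f h (pure_tensor K (UP K) A \<one>\<^bsub>UP K\<^esub> (a \<otimes>\<^bsub>A\<^esub> b))) y) x"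
  unfolding ptensor_def Cur_pure_tensor[symmetric]
  by (subst Cur_def) (simp add: Let_def module.defs conformal_algebra.defs ptensor_def)

lemma pure_one_smult:
  assumes "k \<in> carrier K" "a \<in> carrier A"
  shows "pure_tensor K (UP K) A \<one>\<^bsub>UP K\<^esub> (k \<odot>\<^bsub>A\<^esub> a)
    = const k \<odot>\<^bsub>Cur K A\<^esub> pure_tensor K (UP K) A \<one>\<^bsub>UP K\<^esub> a"
  using HA.pure_tensor_balanced[of k "\<one>\<^bsub>UP K\<^esub>" a] assms by (simp add: smult_eq_const_mult)

lemma Cur_pprod_balanced_bimap:
  "balanced_bimap K (UP K) A K (UP K) A Cur.PT (tensor_group (UP K) (HH_module K) (Cur K A))
     (\<lambda>f a h b. ptensor K (Cur K A) f h (pure_tensor K (UP K) A \<one>\<^bsub>UP K\<^esub> (a \<otimes>\<^bsub>A\<^esub> b)))"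
proof (intro balanced_bimap.intro balanced_bimap_axioms.intro HA.module_pair_axioms
    Cur.P.tensor_abelian_group)
  fix h b
  assume "h \<in> carrier (UP K)" "b \<in> carrier A"
  then show "balanced_map K (UP K) A Cur.PT (tensor_group (UP K) (HH_module K) (Cur K A))
     (\<lambda>f a. ptensor K (Cur K A) f h (pure_tensor K (UP K) A \<one>\<^bsub>UP K\<^esub> (a \<otimes>\<^bsub>A\<^esub> b)))"
    using Cur.ptensor_add(3)[of _ h]
    by unfold_locales
      (simp_all add: Cur.ptensor_add(1) A_mult_add_left HA.pure_tensor_add_right
        A_mult_smult_left pure_one_smult Cur.ptensor_smult_const del: Cur_sel(4))
next
  fix f a
  assume "f \<in> carrier (UP K)" "a \<in> carrier A"
  then show "balanced_map K (UP K) A Cur.PT (tensor_group (UP K) (HH_module K) (Cur K A))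
     (\<lambda>h b. ptensor K (Cur K A) f h (pure_tensor K (UP K) A \<one>\<^bsub>UP K\<^esub> (a \<otimes>\<^bsub>A\<^esub> b)))"
    using Cur.ptensor_add(3)[of f]
    by unfold_locales
      (simp_all add: Cur.ptensor_add(2) A_mult_add_right HA.pure_tensor_add_right
        A_mult_smult_right pure_one_smult Cur.ptensor_smult_const Cur.ptensor_smult_right del: Cur_sel(4))
qed

lemmas Cur_pprod_closed =
  balanced_bimap.bilift_closed[OF Cur_pprod_balanced_bimap, folded Cur_pprod_eq]
lemmas Cur_pprod_pure =
  balanced_bimap.bilift_pure[OF Cur_pprod_balanced_bimap, folded Cur_pprod_eq]
lemmas Cur_pprod_add_left =
  balanced_bimap.bilift_add_left[OF Cur_pprod_balanced_bimap, folded Cur_pprod_eq]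
lemmas Cur_pprod_add_right =
  balanced_bimap.bilift_add_right[OF Cur_pprod_balanced_bimap, folded Cur_pprod_eq]

sublocale Cur: conformal K "Cur K A"
  by (intro conformal.intro Cur.pseudotensor_module_axioms conformal_axioms.intro)
    (simp add: Cur_pprod_closed)

abbreviation D where "D \<equiv> conformal_dialgebra K (Cur K A)"

text \<open>
  Identifying \<open>H \<otimes> A\<close> with \<open>A[T]\<close>, the operations become \<open>x \<turnstile> y = x(0) y(T)\<close> and
  \<open>x \<stileturn> y = x(T) y(0)\<close>.
\<close>

lemma vdash_pure [simp]:
  assumes "f \<in> carrier (UP K)" "a \<in> carrier A" "h \<in> carrier (UP K)" "b \<in> carrier A"
  shows "vdash D (pure_tensor K (UP K) A f a) (pure_tensor K (UP K) A h b)
    = pure_tensor K (UP K) A (H_counit K f \<odot>\<^bsub>UP K\<^esub> h) (a \<otimes>\<^bsub>A\<^esub> b)"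
proof -
  have "vdash D (pure_tensor K (UP K) A f a) (pure_tensor K (UP K) A h b)
      = Cur.left.fold_PT (ptensor K (Cur K A) f h (pure_tensor K (UP K) A \<one>\<^bsub>UP K\<^esub> (a \<otimes>\<^bsub>A\<^esub> b)))"
    using assms Cur.vdash_eq[of "pure_tensor K (UP K) A f a" "pure_tensor K (UP K) A h b"]
    by (simp only: Cur_pprod_pure Cur_sel HA.pure_tensor_closed)
  also have "\<dots> = (const (H_counit K f) \<otimes>\<^bsub>UP K\<^esub> h) \<odot>\<^bsub>Cur K A\<^esub> pure_tensor K (UP K) A \<one>\<^bsub>UP K\<^esub> (a \<otimes>\<^bsub>A\<^esub> b)"
    by (rule Cur.left.fold_PT_ptensor) (use assms in simp_all)
  also have "\<dots> = pure_tensor K (UP K) A (H_counit K f \<odot>\<^bsub>UP K\<^esub> h) (a \<otimes>\<^bsub>A\<^esub> b)"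
    using assms by (simp add: smult_eq_const_mult)
  finally show ?thesis .
qed

lemma dashv_pure [simp]:
  assumes "f \<in> carrier (UP K)" "a \<in> carrier A" "h \<in> carrier (UP K)" "b \<in> carrier A"
  shows "dashv D (pure_tensor K (UP K) A f a) (pure_tensor K (UP K) A h b)
    = pure_tensor K (UP K) A (H_counit K h \<odot>\<^bsub>UP K\<^esub> f) (a \<otimes>\<^bsub>A\<^esub> b)"
proof -
  have "dashv D (pure_tensor K (UP K) A f a) (pure_tensor K (UP K) A h b)
      = Cur.right.fold_PT (ptensor K (Cur K A) f h (pure_tensor K (UP K) A \<one>\<^bsub>UP K\<^esub> (a \<otimes>\<^bsub>A\<^esub> b)))"
    using assms Cur.dashv_eq[of "pure_tensor K (UP K) A f a" "pure_tensor K (UP K) A h b"]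
    by (simp only: Cur_pprod_pure Cur_sel HA.pure_tensor_closed)
  also have "\<dots> = (f \<otimes>\<^bsub>UP K\<^esub> const (H_counit K h)) \<odot>\<^bsub>Cur K A\<^esub> pure_tensor K (UP K) A \<one>\<^bsub>UP K\<^esub> (a \<otimes>\<^bsub>A\<^esub> b)"
    by (rule Cur.right.fold_PT_ptensor) (use assms in simp_all)
  also have "\<dots> = pure_tensor K (UP K) A (H_counit K h \<odot>\<^bsub>UP K\<^esub> f) (a \<otimes>\<^bsub>A\<^esub> b)"
    using assms by (simp add: smult_eq_const_mult U.m_comm)
  finally show ?thesis .
qed

lemma vdash_add:
  assumes "x \<in> carrier HA" "y \<in> carrier HA" "z \<in> carrier HA"
  shows "vdash D (x \<oplus>\<^bsub>HA\<^esub> y) z = vdash D x z \<oplus>\<^bsub>HA\<^esub> vdash D y z"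
    and "vdash D x (y \<oplus>\<^bsub>HA\<^esub> z) = vdash D x y \<oplus>\<^bsub>HA\<^esub> vdash D x z"
  using assms Cur.left.fold_PT_add Cur_pprod_closed
  by (simp_all add: Cur.vdash_eq Cur_pprod_add_left Cur_pprod_add_right)

lemma dashv_add:
  assumes "x \<in> carrier HA" "y \<in> carrier HA" "z \<in> carrier HA"
  shows "dashv D (x \<oplus>\<^bsub>HA\<^esub> y) z = dashv D x z \<oplus>\<^bsub>HA\<^esub> dashv D y z"
    and "dashv D x (y \<oplus>\<^bsub>HA\<^esub> z) = dashv D x y \<oplus>\<^bsub>HA\<^esub> dashv D x z"
  using assms Cur.right.fold_PT_add Cur_pprod_closed
  by (simp_all add: Cur.dashv_eq Cur_pprod_add_left Cur_pprod_add_right)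

end

section \<open>Embeddings into current conformal algebras\<close>

text \<open>
  Induces the map taking an element of \<open>A[T]\<close> to its \<open>n\<close>-th coefficient.
\<close>

lemma (in current_module) coefficient_balanced_map:
  "balanced_map K (UP K) A A (add_monoid A) (\<lambda>f a. coeff (UP K) f n \<odot>\<^bsub>A\<^esub> a)"
  by unfold_locales
    (simp_all add: A.smult_l_distr A.smult_r_distr A.smult_assoc1[symmetric] K.m_comm)

text \<open>
  With \<open>\<rho>(x) = p(x) + T q(x)\<close> in \<open>A[T]\<close>, the difference \<open>\<rho>(x) \<turnstile> \<rho>(y) - \<rho>(y) \<stileturn> \<rho>(x)\<close> equals
  \<open>(p(x) p(y) - p(y) p(x)) + T (p(x) q(y) - q(y) p(x))\<close>. It is \<open>\<rho>([x y])\<close> as soon as \<open>p\<close> takes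
  the bracket to the commutator, \<open>p(x) q(y) = q([x y])\<close> and \<open>q(y) p(x) = 0\<close>. The coefficient of \<open>T\<close>
  recovers \<open>q(x)\<close> from \<open>\<rho>(x)\<close>, so \<open>\<rho>\<close> is injective if \<open>q\<close> is.
\<close>

lemma (in current_algebra) linear_current_embedding:
  fixes p q
  defines "\<rho> \<equiv> \<lambda>x. pure_tensor K (UP K) A \<one>\<^bsub>UP K\<^esub> (p x) \<oplus>\<^bsub>HA\<^esub> pure_tensor K (UP K) A T (q x)"
  assumes L: "\<And>x y. \<lbrakk>x \<in> carrier L; y \<in> carrier L\<rbrakk> \<Longrightarrow> x \<otimes>\<^bsub>L\<^esub> y \<in> carrier L"
    and p: "p \<in> module_hom K L A" and q: "q \<in> module_hom K L A" and inj: "inj_on q (carrier L)"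
    and pp: "\<And>x y. \<lbrakk>x \<in> carrier L; y \<in> carrier L\<rbrakk> \<Longrightarrow>
      p (x \<otimes>\<^bsub>L\<^esub> y) \<oplus>\<^bsub>A\<^esub> p y \<otimes>\<^bsub>A\<^esub> p x = p x \<otimes>\<^bsub>A\<^esub> p y"
    and pq: "\<And>x y. \<lbrakk>x \<in> carrier L; y \<in> carrier L\<rbrakk> \<Longrightarrow> p x \<otimes>\<^bsub>A\<^esub> q y = q (x \<otimes>\<^bsub>L\<^esub> y)"
    and qp: "\<And>x y. \<lbrakk>x \<in> carrier L; y \<in> carrier L\<rbrakk> \<Longrightarrow> q x \<otimes>\<^bsub>A\<^esub> p y = \<zero>\<^bsub>A\<^esub>"
  shows "\<rho> \<in> module_hom K L D" and "inj_on \<rho> (carrier L)"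
    and "\<And>x y. \<lbrakk>x \<in> carrier L; y \<in> carrier L\<rbrakk> \<Longrightarrow>
      \<rho> (x \<otimes>\<^bsub>L\<^esub> y) = vdash D (\<rho> x) (\<rho> y) \<ominus>\<^bsub>D\<^esub> dashv D (\<rho> y) (\<rho> x)"
proof -
  have closed [simp]: "p x \<in> carrier A" "q x \<in> carrier A" if "x \<in> carrier L" for x
    using module_hom_closed[OF p] module_hom_closed[OF q] that by auto
  have \<rho>_closed [simp]: "\<rho> x \<in> carrier HA" if "x \<in> carrier L" for x
    using that by (simp add: \<rho>_def)
  interpret C: module "UP K" "Cur K A"
    by (rule Cur_is_module)
  have const_smult_pure: "const_smult K (Cur K A) k (pure_tensor K (UP K) A f a)
      = pure_tensor K (UP K) A f (k \<odot>\<^bsub>A\<^esub> a)"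
    if "k \<in> carrier K" "f \<in> carrier (UP K)" "a \<in> carrier A" for k f a
    using that HA.pure_tensor_balanced[of k f a] by (simp add: const_smult_def smult_eq_const_mult)
  show "\<rho> \<in> module_hom K L D"
    unfolding module_hom_def
  proof (intro CollectI conjI allI impI)
    show "\<rho> \<in> carrier L \<rightarrow> carrier D"
      by simp
  next
    fix x y
    assume "x \<in> carrier L \<and> y \<in> carrier L"
    then show "\<rho> (x \<oplus>\<^bsub>L\<^esub> y) = \<rho> x \<oplus>\<^bsub>D\<^esub> \<rho> y"
      by (simp add: \<rho>_def module_hom_add[OF p] module_hom_add[OF q] HA.pure_tensor_add_right HA.T.a_ac)
  next
    fix k x
    assume "k \<in> carrier K \<and> x \<in> carrier L"
    moreover from this have "const_smult K (Cur K A) k (\<rho> x)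
        = const_smult K (Cur K A) k (pure_tensor K (UP K) A \<one>\<^bsub>UP K\<^esub> (p x))
          \<oplus>\<^bsub>HA\<^esub> const_smult K (Cur K A) k (pure_tensor K (UP K) A T (q x))"
      by (simp add: \<rho>_def const_smult_def Cur_smult_add)
    ultimately show "\<rho> (k \<odot>\<^bsub>L\<^esub> x) = k \<odot>\<^bsub>D\<^esub> \<rho> x"
      by (simp add: const_smult_pure) (simp add: \<rho>_def module_hom_smult[OF p] module_hom_smult[OF q])
  qed
  \<comment> \<open>the coefficient of \<open>T\<close>\<close>
  interpret coeff1: balanced_map K "UP K" A A "add_monoid A" "\<lambda>f a. coeff (UP K) f (Suc 0) \<odot>\<^bsub>A\<^esub> a"
    by (rule coefficient_balanced_map)
  have coeff: "tensor_lift (add_monoid A) (\<lambda>f a. coeff (UP K) f (Suc 0) \<odot>\<^bsub>A\<^esub> a) (\<rho> x) = q x"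
    if "x \<in> carrier L" for x
    using that by (simp add: \<rho>_def coeff1.tensor_lift_add coeff1.tensor_lift_pure)
  show "inj_on \<rho> (carrier L)"
  proof (rule inj_onI)
    fix x y
    assume xy: "x \<in> carrier L" "y \<in> carrier L" "\<rho> x = \<rho> y"
    have "q x = q y"
      using coeff[OF xy(1)] coeff[OF xy(2)] xy(3) by simp
    then show "x = y"
      using inj xy(1,2) by (simp add: inj_on_eq_iff)
  qed
  interpret DG: abelian_group D
    by (rule abelian_group_cong[OF HA.tensor_abelian_group]) simp_all
  show "\<rho> (x \<otimes>\<^bsub>L\<^esub> y) = vdash D (\<rho> x) (\<rho> y) \<ominus>\<^bsub>D\<^esub> dashv D (\<rho> y) (\<rho> x)"
    if xy: "x \<in> carrier L" "y \<in> carrier L" for x y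
  proof -
    note distrib = vdash_add dashv_add HA.pure_tensor_zero_left HA.pure_tensor_zero_right
    have v: "vdash D (\<rho> x) (\<rho> y) = pure_tensor K (UP K) A \<one>\<^bsub>UP K\<^esub> (p x \<otimes>\<^bsub>A\<^esub> p y)
        \<oplus>\<^bsub>HA\<^esub> pure_tensor K (UP K) A T (p x \<otimes>\<^bsub>A\<^esub> q y)"
      using xy by (simp add: \<rho>_def distrib)
    have d: "dashv D (\<rho> y) (\<rho> x) = pure_tensor K (UP K) A \<one>\<^bsub>UP K\<^esub> (p y \<otimes>\<^bsub>A\<^esub> p x)"
      using xy by (simp add: \<rho>_def distrib qp)
    have "\<rho> (x \<otimes>\<^bsub>L\<^esub> y) \<oplus>\<^bsub>HA\<^esub> dashv D (\<rho> y) (\<rho> x) = vdash D (\<rho> x) (\<rho> y)"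
      unfolding v d pp[OF xy, symmetric] pq[OF xy]
      using xy L[OF xy] by (simp add: \<rho>_def HA.pure_tensor_add_right HA.T.a_ac)
    then have eq: "vdash D (\<rho> x) (\<rho> y) = \<rho> (x \<otimes>\<^bsub>L\<^esub> y) \<oplus>\<^bsub>D\<^esub> dashv D (\<rho> y) (\<rho> x)"
      by simp
    have c: "\<rho> (x \<otimes>\<^bsub>L\<^esub> y) \<in> carrier D" "dashv D (\<rho> y) (\<rho> x) \<in> carrier D"
      using xy L[OF xy] by (simp_all add: d)
    show ?thesis
      unfolding eq a_minus_def using DG.add.inv_solve_right[OF c(1) DG.a_closed[OF c] c(2)] by blast
  qed
qed


section \<open>The algebra of linear transformations\<close>

lemma End_algebra_memI:
  assumes "\<And>w. w \<in> carrier W \<Longrightarrow> f w \<in> carrier W"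
    and "\<And>w w'. \<lbrakk>w \<in> carrier W; w' \<in> carrier W\<rbrakk> \<Longrightarrow> f (w \<oplus>\<^bsub>W\<^esub> w') = f w \<oplus>\<^bsub>W\<^esub> f w'"
    and "\<And>k w. \<lbrakk>k \<in> carrier K; w \<in> carrier W\<rbrakk> \<Longrightarrow> f (k \<odot>\<^bsub>W\<^esub> w) = k \<odot>\<^bsub>W\<^esub> f w"
    and "module K W"
  shows "(\<lambda>w\<in>carrier W. f w) \<in> carrier (End_algebra K W)"
proof -
  interpret module K W by fact
  show ?thesis
    using assms(1-3) by (auto simp: End_algebra_def module_hom_def)
qed

lemma End_algebraE:
  assumes "f \<in> carrier (End_algebra K W)"
  shows "\<And>w. w \<in> carrier W \<Longrightarrow> f w \<in> carrier W"
    and "\<And>w w'. \<lbrakk>w \<in> carrier W; w' \<in> carrier W\<rbrakk> \<Longrightarrow> f (w \<oplus>\<^bsub>W\<^esub> w') = f w \<oplus>\<^bsub>W\<^esub> f w'"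
    and "\<And>k w. \<lbrakk>k \<in> carrier K; w \<in> carrier W\<rbrakk> \<Longrightarrow> f (k \<odot>\<^bsub>W\<^esub> w) = k \<odot>\<^bsub>W\<^esub> f w"
    and "f \<in> extensional (carrier W)"
  using assms by (auto simp: End_algebra_def module_hom_def)

lemma End_algebra_sel:
  "add (End_algebra K W) = (\<lambda>f g. \<lambda>w\<in>carrier W. f w \<oplus>\<^bsub>W\<^esub> g w)"
  "f \<otimes>\<^bsub>End_algebra K W\<^esub> g = compose (carrier W) f g"
  "k \<odot>\<^bsub>End_algebra K W\<^esub> f = (\<lambda>w\<in>carrier W. k \<odot>\<^bsub>W\<^esub> f w)"
  "\<zero>\<^bsub>End_algebra K W\<^esub> = (\<lambda>w\<in>carrier W. \<zero>\<^bsub>W\<^esub>)"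
  by (simp_all add: End_algebra_def)

lemma End_algebra_current_algebra:
  assumes "module K W"
  shows "current_algebra K (End_algebra K W)"
proof -
  interpret W: module K W by fact
  let ?E = "End_algebra K W"
  note E = End_algebraE
  note eqI = extensionalityI[of _ "carrier W"]
  have add: "f \<oplus>\<^bsub>?E\<^esub> g \<in> carrier ?E" if "f \<in> carrier ?E" "g \<in> carrier ?E" for f g
    unfolding End_algebra_sel
    by (rule End_algebra_memI)
      (simp_all add: E[OF that(1)] E[OF that(2)] W.M.a_ac W.smult_r_distr assms)
  have smult: "k \<odot>\<^bsub>?E\<^esub> f \<in> carrier ?E" if "k \<in> carrier K" "f \<in> carrier ?E" for k f
    unfolding End_algebra_sel
    by (rule End_algebra_memI)
      (simp_all add: E[OF that(2)] that(1) W.smult_r_distr W.smult_assoc1[symmetric] W.R.m_comm assms)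
  have zero: "\<zero>\<^bsub>?E\<^esub> \<in> carrier ?E"
    unfolding End_algebra_sel by (rule End_algebra_memI) (simp_all add: assms)
  have mult: "f \<otimes>\<^bsub>?E\<^esub> g \<in> carrier ?E" if "f \<in> carrier ?E" "g \<in> carrier ?E" for f g
    unfolding End_algebra_sel compose_def
    by (rule End_algebra_memI) (simp_all add: E[OF that(1)] E[OF that(2)] assms)
  have neg: "(\<lambda>w\<in>carrier W. \<ominus>\<^bsub>W\<^esub> f w) \<in> carrier ?E" if "f \<in> carrier ?E" for f
    by (rule End_algebra_memI)
      (simp_all add: E[OF that] W.M.minus_add W.smult_r_minus assms)
  have abelian: "abelian_group ?E"
  proof (rule abelian_groupI)
    fix f g h
    assume h: "f \<in> carrier ?E" "g \<in> carrier ?E" "h \<in> carrier ?E"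
    then show "f \<oplus>\<^bsub>?E\<^esub> g \<oplus>\<^bsub>?E\<^esub> h = f \<oplus>\<^bsub>?E\<^esub> (g \<oplus>\<^bsub>?E\<^esub> h)"
      by (intro eqI) (simp_all add: End_algebra_sel E[OF h(1)] E[OF h(2)] E[OF h(3)] W.M.a_assoc)
  next
    fix f g
    assume h: "f \<in> carrier ?E" "g \<in> carrier ?E"
    then show "f \<oplus>\<^bsub>?E\<^esub> g = g \<oplus>\<^bsub>?E\<^esub> f"
      by (intro eqI) (simp_all add: End_algebra_sel E[OF h(1)] E[OF h(2)] W.M.a_comm)
  next
    fix f
    assume h: "f \<in> carrier ?E"
    show "\<zero>\<^bsub>?E\<^esub> \<oplus>\<^bsub>?E\<^esub> f = f"
      by (intro eqI) (simp_all add: End_algebra_sel E[OF h])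
    have "(\<lambda>w\<in>carrier W. \<ominus>\<^bsub>W\<^esub> f w) \<oplus>\<^bsub>?E\<^esub> f = \<zero>\<^bsub>?E\<^esub>"
      by (intro eqI) (simp_all add: End_algebra_sel E[OF h] W.M.l_neg)
    with neg[OF h] show "\<exists>g\<in>carrier ?E. g \<oplus>\<^bsub>?E\<^esub> f = \<zero>\<^bsub>?E\<^esub>"
      by blast
  qed (use add zero in auto)
  have "module K ?E"
  proof (rule moduleI)
    fix k l f
    assume k: "k \<in> carrier K" "l \<in> carrier K" and f: "f \<in> carrier ?E"
    show "(k \<oplus>\<^bsub>K\<^esub> l) \<odot>\<^bsub>?E\<^esub> f = k \<odot>\<^bsub>?E\<^esub> f \<oplus>\<^bsub>?E\<^esub> l \<odot>\<^bsub>?E\<^esub> f"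
      by (intro eqI) (simp_all add: End_algebra_sel k E[OF f] W.smult_l_distr)
    show "(k \<otimes>\<^bsub>K\<^esub> l) \<odot>\<^bsub>?E\<^esub> f = k \<odot>\<^bsub>?E\<^esub> (l \<odot>\<^bsub>?E\<^esub> f)"
      by (intro eqI) (simp_all add: End_algebra_sel k E[OF f] W.smult_assoc1)
  next
    fix k f g
    assume h: "k \<in> carrier K" "f \<in> carrier ?E" "g \<in> carrier ?E"
    show "k \<odot>\<^bsub>?E\<^esub> (f \<oplus>\<^bsub>?E\<^esub> g) = k \<odot>\<^bsub>?E\<^esub> f \<oplus>\<^bsub>?E\<^esub> k \<odot>\<^bsub>?E\<^esub> g"
      by (intro eqI) (simp_all add: End_algebra_sel h(1) E[OF h(2)] E[OF h(3)] W.smult_r_distr)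
  next
    fix f
    assume h: "f \<in> carrier ?E"
    show "\<one>\<^bsub>K\<^esub> \<odot>\<^bsub>?E\<^esub> f = f"
      by (intro eqI) (simp_all add: End_algebra_sel E[OF h])
  qed (use abelian smult W.R.is_cring in auto)
  moreover have "current_algebra_axioms K ?E"
  proof
    fix f g h
    assume h: "f \<in> carrier ?E" "g \<in> carrier ?E" "h \<in> carrier ?E"
    show "(f \<oplus>\<^bsub>?E\<^esub> g) \<otimes>\<^bsub>?E\<^esub> h = f \<otimes>\<^bsub>?E\<^esub> h \<oplus>\<^bsub>?E\<^esub> g \<otimes>\<^bsub>?E\<^esub> h"
      by (intro eqI) (simp_all add: End_algebra_sel compose_def E[OF h(1)] E[OF h(2)] E[OF h(3)])
    show "f \<otimes>\<^bsub>?E\<^esub> (g \<oplus>\<^bsub>?E\<^esub> h) = f \<otimes>\<^bsub>?E\<^esub> g \<oplus>\<^bsub>?E\<^esub> f \<otimes>\<^bsub>?E\<^esub> h"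
      by (intro eqI) (simp_all add: End_algebra_sel compose_def E[OF h(1)] E[OF h(2)] E[OF h(3)])
  next
    fix k f g
    assume h: "k \<in> carrier K" "f \<in> carrier ?E" "g \<in> carrier ?E"
    show "(k \<odot>\<^bsub>?E\<^esub> f) \<otimes>\<^bsub>?E\<^esub> g = k \<odot>\<^bsub>?E\<^esub> (f \<otimes>\<^bsub>?E\<^esub> g)"
      by (intro eqI) (simp_all add: End_algebra_sel compose_def h(1) E[OF h(2)] E[OF h(3)])
    show "f \<otimes>\<^bsub>?E\<^esub> (k \<odot>\<^bsub>?E\<^esub> g) = k \<odot>\<^bsub>?E\<^esub> (f \<otimes>\<^bsub>?E\<^esub> g)"
      by (intro eqI) (simp_all add: End_algebra_sel compose_def h(1) E[OF h(2)] E[OF h(3)])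
  qed (rule mult)
  ultimately show ?thesis
    by (intro current_algebra.intro current_module.intro polynomial_hopf_algebra.intro W.R.is_cring)
qed


section \<open>The representation of a Leibniz algebra\<close>

definition ground_module :: "('k, 'm) ring_scheme \<Rightarrow> ('k, 'k) module" where
  "ground_module K = \<lparr>carrier = carrier K, mult = monoid.mult K, one = \<one>\<^bsub>K\<^esub>,
     ring.zero = \<zero>\<^bsub>K\<^esub>, add = add K, smult = monoid.mult K\<rparr>"

lemma (in cring) ground_module_module: "module R (ground_module R)"
proof (rule moduleI)
  show "abelian_group (ground_module R)"
    by (rule abelian_group_cong[OF abelian_group_axioms]) (simp_all add: ground_module_def)
qed (simp_all add: ground_module_def l_distr r_distr m_assoc is_cring)

lemma direct_sum_ground_sel:
  "carrier (direct_sum (ground_module K) L) = carrier K \<times> carrier L"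
  "v \<oplus>\<^bsub>direct_sum (ground_module K) L\<^esub> w = (fst v \<oplus>\<^bsub>K\<^esub> fst w, snd v \<oplus>\<^bsub>L\<^esub> snd w)"
  "k \<odot>\<^bsub>direct_sum (ground_module K) L\<^esub> v = (k \<otimes>\<^bsub>K\<^esub> fst v, k \<odot>\<^bsub>L\<^esub> snd v)"
  "\<zero>\<^bsub>direct_sum (ground_module K) L\<^esub> = (\<zero>\<^bsub>K\<^esub>, \<zero>\<^bsub>L\<^esub>)"
  by (simp_all add: direct_sum_def ground_module_def)

context leibniz_algebra
begin

abbreviation W where "W \<equiv> direct_sum (ground_module K) L"

definition bracket_map where
  "bracket_map x = (\<lambda>w\<in>carrier W. (\<zero>\<^bsub>K\<^esub>, x \<otimes>\<^bsub>L\<^esub> snd w))"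

definition point_map where
  "point_map x = (\<lambda>w\<in>carrier W. (\<zero>\<^bsub>K\<^esub>, fst w \<odot>\<^bsub>L\<^esub> x))"

lemma W_module: "module K W"
  by (intro direct_sum_is_module R.ground_module_module module.module_axioms)

lemma W_vectorspace: "vectorspace K W"
  by (intro vectorspace.intro W_module field.field_axioms)

lemma bracket_map_hom: "bracket_map \<in> module_hom K L (End_algebra K W)"
  unfolding module_hom_def
proof (intro CollectI conjI allI impI)
  show "bracket_map \<in> carrier L \<rightarrow> carrier (End_algebra K W)"
    unfolding bracket_map_def
    by (intro funcsetI End_algebra_memI)
      (auto simp: direct_sum_ground_sel bracket_closed bracket_add_right bracket_smult_right W_module)
qed (auto simp: End_algebra_sel bracket_map_def direct_sum_ground_sel
      bracket_add_left bracket_smult_left intro!: restrict_ext)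

lemma point_map_hom: "point_map \<in> module_hom K L (End_algebra K W)"
  unfolding module_hom_def
proof (intro CollectI conjI allI impI)
  show "point_map \<in> carrier L \<rightarrow> carrier (End_algebra K W)"
    unfolding point_map_def
    by (intro funcsetI End_algebra_memI)
      (auto simp: direct_sum_ground_sel smult_l_distr smult_assoc1 W_module)
qed (auto simp: End_algebra_sel point_map_def direct_sum_ground_sel
      smult_r_distr smult_assoc1[symmetric] R.m_comm intro!: restrict_ext)

text \<open>
  The first summand of \<open>W\<close> is there for this: \<open>x\<close> is recovered as the image of \<open>(1, 0)\<close>, even if
  \<open>x\<close> acts as zero on \<open>L\<close>.
\<close>

lemma point_map_inj: "inj_on point_map (carrier L)"
proof (rule inj_onI)
  fix x y
  assume xy: "x \<in> carrier L" "y \<in> carrier L" "point_map x = point_map y"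
  have "point_map z (\<one>\<^bsub>K\<^esub>, \<zero>\<^bsub>L\<^esub>) = (\<zero>\<^bsub>K\<^esub>, z)" if "z \<in> carrier L" for z
    using that by (simp add: point_map_def direct_sum_ground_sel)
  with xy show "x = y"
    by (metis prod.inject)
qed

text \<open>
  On the second component this is the Leibniz identity
  \<open>[[x y] z] + [y [x z]] = [x [y z]]\<close>.
\<close>

lemma bracket_map_bracket:
  assumes "x \<in> carrier L" "y \<in> carrier L"
  shows "bracket_map (x \<otimes>\<^bsub>L\<^esub> y) \<oplus>\<^bsub>End_algebra K W\<^esub> bracket_map y \<otimes>\<^bsub>End_algebra K W\<^esub> bracket_map x
    = bracket_map x \<otimes>\<^bsub>End_algebra K W\<^esub> bracket_map y"
  using assms
  by (auto simp: End_algebra_sel compose_def bracket_map_def direct_sum_ground_sel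
      bracket_closed left_leibniz[of x y] intro!: restrict_ext)

lemma bracket_map_point_map:
  assumes "x \<in> carrier L" "y \<in> carrier L"
  shows "bracket_map x \<otimes>\<^bsub>End_algebra K W\<^esub> point_map y = point_map (x \<otimes>\<^bsub>L\<^esub> y)"
  using assms
  by (auto simp: End_algebra_sel compose_def bracket_map_def point_map_def direct_sum_ground_sel
      bracket_smult_right intro!: restrict_ext)

text \<open>
  The image of \<open>bracket_map y\<close> lies in the second summand, which \<open>point_map x\<close> kills.
\<close>

lemma point_map_bracket_map:
  assumes "x \<in> carrier L" "y \<in> carrier L"
  shows "point_map x \<otimes>\<^bsub>End_algebra K W\<^esub> bracket_map y = \<zero>\<^bsub>End_algebra K W\<^esub>"
  using assms
  by (auto simp: End_algebra_sel compose_def bracket_map_def point_map_def direct_sum_ground_sel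
      bracket_closed intro!: restrict_ext)

lemma ex_current_embedding: "\<exists>\<rho>. current_embedding K L W \<rho>"
proof -
  interpret E: current_algebra K "End_algebra K W"
    by (rule End_algebra_current_algebra[OF W_module])
  show ?thesis
    unfolding current_embedding_def Let_def
    using E.linear_current_embedding[of L bracket_map point_map, OF bracket_closed bracket_map_hom
        point_map_hom point_map_inj bracket_map_bracket bracket_map_point_map point_map_bracket_map]
    by blast
qed

lemma fin_dim_W:
  assumes "fin_dim"
  shows "vectorspace.fin_dim K W"
proof -
  interpret W: vectorspace K W
    by (rule W_vectorspace)
  obtain B where B: "finite B" "B \<subseteq> carrier L" "span B = carrier L"
    using assms unfolding fin_dim_def by blast
  let ?A = "insert (\<one>\<^bsub>K\<^esub>, \<zero>\<^bsub>L\<^esub>) (Pair \<zero>\<^bsub>K\<^esub> ` B)"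
  have A: "?A \<subseteq> carrier W"
    using B(2) by (auto simp: direct_sum_ground_sel)
  interpret S: submodule K "W.span ?A" W
    by (rule W.span_is_submodule[OF A])
  \<comment> \<open>The span of \<open>B\<close> lies in every submodule containing \<open>B\<close>, in particular in the preimage of the
    span of \<open>?A\<close> under the inclusion of \<open>L\<close>.\<close>
  have "submodule K {x \<in> carrier L. (\<zero>\<^bsub>K\<^esub>, x) \<in> W.span ?A} L"
    apply (rule submodule.intro)
    using S.m_closed[of "(\<zero>\<^bsub>K\<^esub>, _)" "(\<zero>\<^bsub>K\<^esub>, _)"] S.smult_closed[of _ "(\<zero>\<^bsub>K\<^esub>, _)"] S.zero_closed
    by (auto simp: direct_sum_ground_sel module.module_axioms)
  then have "span B \<subseteq> {x \<in> carrier L. (\<zero>\<^bsub>K\<^esub>, x) \<in> W.span ?A}"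
    using B(2) W.in_own_span[OF A] by (intro span_is_subset) auto
  then have right: "(\<zero>\<^bsub>K\<^esub>, x) \<in> W.span ?A" if "x \<in> carrier L" for x
    using that B(3) by blast
  have "carrier W \<subseteq> W.span ?A"
  proof
    fix w
    assume "w \<in> carrier W"
    then obtain c x where w: "w = (c, x)" "c \<in> carrier K" "x \<in> carrier L"
      by (auto simp: direct_sum_ground_sel)
    have "c \<odot>\<^bsub>W\<^esub> (\<one>\<^bsub>K\<^esub>, \<zero>\<^bsub>L\<^esub>) \<oplus>\<^bsub>W\<^esub> (\<zero>\<^bsub>K\<^esub>, x) \<in> W.span ?A"
      using W.in_own_span[OF A] w right by (intro S.m_closed S.smult_closed) auto
    then show "w \<in> W.span ?A"
      using w by (simp add: direct_sum_ground_sel)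
  qed
  then show ?thesis
    using A B(1) S.subset unfolding W.fin_dim_def by (intro exI[of _ ?A]) auto
qed

end

theorem corollary4:
  fixes K :: "('k, 'm) ring_scheme" and L :: "('k, 'l, 'n) module_scheme"
  assumes "field K" and "leibniz_algebra K L"
  shows "(\<exists>(W :: ('k, 'k \<times> 'l) module) \<rho>. vectorspace K W \<and> current_embedding K L W \<rho>) \<and>
         (vectorspace.fin_dim K L \<longrightarrow>
           (\<exists>(W :: ('k, 'k \<times> 'l) module) \<rho>.
              vectorspace K W \<and> vectorspace.fin_dim K W \<and> current_embedding K L W \<rho>))"
proof -
  interpret leibniz_algebra K L by fact
  show ?thesis
    using W_vectorspace ex_current_embedding fin_dim_W by blast
qed

end
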